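(* Let $r\geq 4$ and $n\geq 4r+10$ be integers. Then $\sigma(K_{r+1}-(P_2\cup K_2), n)=(r-1)(2n-r)-2(n-r)$.
   Context: A non-increasing sequence $\pi=(d_1,\dots,d_n)$ of nonnegative integers is graphic if it is the degree sequence of a simple graph on $n$ vertices (a realization of $\pi$); $\sigma(\pi)=d_1+\cdots+d_n$. For a graph $F$, $\pi$ is potentially $F$-graphic if some realization of $\pi$ contains $F$ as a subgraph. $\sigma(F,n)$ denotes the smallest even integer $l$ such that every $n$-term graphic sequence $\pi$ with $\sigma(\pi)\geq l$ is potentially $F$-graphic. $K_m$ is the complete graph on $m$ vertices; $P_2$ denotes the path with 2 edges (on 3 vertices); $K_2$ is a single edge; $G\cup H$ is the disjoint union. For a subgraph $H$ of $K_m$, $K_m-H$ is the graph obtained from $K_m$ by deleting the edges of $H$; here $P_2\cup K_2$ is regarded as a subgraph of $K_{r+1}$. *)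

theory Defs
  imports "Graph_Theory.Graph_Theory"
begin

text \<open>
  A simple graph is a finite symmetric loopless digraph without parallel arcs
  (\<^locale>\<open>pair_graph\<close>): an edge \<open>uv\<close> is represented by the two arcs \<open>(u, v)\<close> and \<open>(v, u)\<close>,
  so the degree of a vertex is its out-degree. Vertices of realizations are taken from
  \<^typ>\<open>nat\<close>, which loses no finite graph up to isomorphism.
\<close>

definition degree_sequence :: "'a pair_pre_digraph \<Rightarrow> nat list" where
  "degree_sequence G =
     rev (sorted_list_of_multiset (image_mset (out_degree (with_proj G)) (mset_set (pverts G))))"

definition realization :: "nat pair_pre_digraph \<Rightarrow> nat list \<Rightarrow> bool" where
  "realization G d \<longleftrightarrow> pair_graph G \<and> degree_sequence G = d"

definition graphic :: "nat list \<Rightarrow> bool" where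
  "graphic d \<longleftrightarrow> (\<exists>G. realization G d)"

definition contains_copy :: "'a pair_pre_digraph \<Rightarrow> 'b pair_pre_digraph \<Rightarrow> bool" where
  "contains_copy G F \<longleftrightarrow>
     (\<exists>H :: 'a pair_pre_digraph.
        subgraph (with_proj H) (with_proj G) \<and> digraph_iso (with_proj F) (with_proj H))"

definition potentially_graphic :: "'b pair_pre_digraph \<Rightarrow> nat list \<Rightarrow> bool" where
  "potentially_graphic F d \<longleftrightarrow> (\<exists>G. realization G d \<and> contains_copy G F)"

text \<open>
  The minimum exists whenever \<open>F\<close> has an edge: every sufficiently large even \<open>l\<close> qualifies
  vacuously, and no \<open>l \<le> 0\<close> does, because of the zero sequence.
\<close>

definition sigma :: "'b pair_pre_digraph \<Rightarrow> nat \<Rightarrow> int" where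
  "sigma F n = (LEAST l :: int. even l \<and>
     (\<forall>d. length d = n \<and> graphic d \<and> int (sum_list d) \<ge> l \<longrightarrow> potentially_graphic F d))"

definition complete_graph :: "nat \<Rightarrow> nat pair_pre_digraph" where
  "complete_graph m = \<lparr> pverts = {..<m}, parcs = {(u, v). u < m \<and> v < m \<and> u \<noteq> v} \<rparr>"

text \<open>The subscript counts edges, so \<open>path_graph k\<close> has \<open>k + 1\<close> vertices.\<close>

definition path_graph :: "nat \<Rightarrow> nat pair_pre_digraph" where
  "path_graph k = \<lparr> pverts = {..k}, parcs = {(u, v). u \<le> k \<and> v \<le> k \<and> (v = Suc u \<or> u = Suc v)} \<rparr>"

definition disjoint_union ::
    "'a pair_pre_digraph \<Rightarrow> 'b pair_pre_digraph \<Rightarrow> ('a + 'b) pair_pre_digraph" where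
  "disjoint_union G H =
     \<lparr> pverts = pverts G <+> pverts H,
       parcs = map_prod Inl Inl ` parcs G \<union> map_prod Inr Inr ` parcs H \<rparr>"

text \<open>Only the edges of \<open>H\<close> are removed; all vertices of \<open>G\<close> are kept.\<close>

definition delete_edges :: "'a pair_pre_digraph \<Rightarrow> 'a pair_pre_digraph \<Rightarrow> 'a pair_pre_digraph" where
  "delete_edges G H = G\<lparr> parcs := parcs G - parcs H \<rparr>"

lemma complete_digraph_complete_graph: "K\<^bsub>m\<^esub> (with_proj (complete_graph m))"
  by (auto simp: complete_digraph_pair_def complete_graph_def)

end

theory Submission
  imports Defs
begin

text \<open>
  Put \<open>k = r - 1\<close>, so that the bound reads \<open>(k - 1) * (2 * n - k) + 2\<close>, and let \<open>S\<close> consist of \<open>k + 2\<close>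
  vertices of largest degree. Some realization makes \<open>S\<close> a clique up to a path with two edges or
  two disjoint edges. Indeed, as in the Havel--Hakimi theorem a vertex of maximum degree can be
  joined to the next largest ones and deleted, and induction on \<open>k\<close> applies unless \<open>S\<close> is no longer
  on top. In that case many vertices outside \<open>S\<close> have the least degree occurring in \<open>S\<close>. Then one
  prescribes the edges inside \<open>S\<close> and spreads the other edges at \<open>S\<close> as evenly as possible over the
  outer vertices of largest degree; the degrees that remain are so flat that they are
  realizable, because the degree sum is large.

  Conversely, the join of \<open>K\<^sub>r\<^sub>-\<^sub>2\<close> with an independent set is the only realization of its
  degree sequence, its degree sum is the bound minus 2, and any \<open>r + 1\<close> of its vertices include
  three independent ones, whereas the path plus an edge deleted from \<open>K\<^sub>r\<^sub>+\<^sub>1\<close> contains no triangle.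
\<close>

section \<open>Realizations as symmetric relations\<close>

text \<open>A relation instead of a pair graph: deleting or adding a vertex becomes a set operation,
  and degrees are a function on named vertices rather than a sorted list.\<close>

definition realizes :: "'a set \<Rightarrow> ('a \<Rightarrow> nat) \<Rightarrow> 'a rel \<Rightarrow> bool" where
  "realizes V d E \<longleftrightarrow> E \<subseteq> V \<times> V \<and> sym E \<and> irrefl E \<and> (\<forall>v\<in>V. card (E `` {v}) = d v)"

lemma realizesD:
  assumes "realizes V d E"
  shows "E \<subseteq> V \<times> V" "sym E" "irrefl E" "v \<in> V \<Longrightarrow> card (E `` {v}) = d v"
  using assms by (auto simp: realizes_def)

lemma realizes_Image_subset:
  "realizes V d E \<Longrightarrow> E `` A \<subseteq> V"
  by (auto simp: realizes_def)

text \<open>The 2-switch: each of the four vertices loses one neighbour and gains one. The adjacency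
  assumptions already force \<open>v \<noteq> z\<close> and \<open>x \<noteq> w\<close>.\<close>

lemma realizes_swap:
  assumes R: "realizes V d E" and "finite V"
    and "(v, x) \<in> E" "(w, z) \<in> E" "(v, w) \<notin> E" "(x, z) \<notin> E" "v \<noteq> w" "x \<noteq> z"
  shows "realizes V d (E - {(v, x), (x, v), (w, z), (z, w)} \<union> {(v, w), (w, v), (x, z), (z, x)})"
    (is "realizes V d ?E'")
proof -
  note D = realizesD[OF R]
  have sym: "\<And>a b. (a, b) \<in> E \<Longrightarrow> (b, a) \<in> E" using D(2) by (auto dest: symD)
  have irr: "\<And>a. (a, a) \<notin> E" using D(3) by (auto simp: irrefl_def)
  have ne: "v \<noteq> x" "w \<noteq> z" "v \<noteq> z" "x \<noteq> w" using assms sym irr by metis+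
  have nn: "(w, v) \<notin> E" "(z, x) \<notin> E" using assms sym by metis+
  have yy: "(x, v) \<in> E" "(z, w) \<in> E" using assms sym by metis+
  have fin: "finite (E `` {u})" for u
    using \<open>finite V\<close> realizes_Image_subset[OF R] by (rule finite_subset[rotated])
  have exch: "card (insert b (E `` {u} - {a})) = card (E `` {u})"
    if "(u, a) \<in> E" "(u, b) \<notin> E" for u a b
    using that fin card_Suc_Diff1[of "E `` {u}" a] by simp
  have "card (?E' `` {u}) = card (E `` {u})" for u
  proof -
    consider "u = v" | "u = w" | "u = x" | "u = z" | "u \<notin> {v, w, x, z}" by blast
    then show ?thesis
    proof cases
      case 1
      have "?E' `` {v} = insert w (E `` {v} - {x})" using assms ne nn yy by auto
      then show ?thesis using 1 exch assms by simp
    next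
      case 2
      have "?E' `` {w} = insert v (E `` {w} - {z})" using assms ne nn yy by auto
      then show ?thesis using 2 exch assms nn by simp
    next
      case 3
      have "?E' `` {x} = insert z (E `` {x} - {v})" using assms ne nn yy by auto
      then show ?thesis using 3 exch assms yy by simp
    next
      case 4
      have "?E' `` {z} = insert x (E `` {z} - {w})" using assms ne nn yy by auto
      then show ?thesis using 4 exch nn yy by simp
    next
      case 5
      have "?E' `` {u} = E `` {u}" using 5 by auto
      then show ?thesis by simp
    qed
  qed
  moreover have "?E' \<subseteq> V \<times> V" using assms D(1) by auto
  moreover have "sym ?E'" using sym by (auto intro!: symI)
  moreover have "irrefl ?E'" using irr assms by (auto simp: irrefl_def)
  ultimately show ?thesis using D(4) by (simp add: realizes_def)
qed

text \<open>The Havel--Hakimi exchange: take a realization with the most neighbours of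
  \<open>v\<close> in \<open>W\<close>. Were some \<open>w\<close> in \<open>W\<close> not among
  them, a switch through a neighbour \<open>x\<close> of \<open>v\<close> outside \<open>W\<close>
  would gain one.\<close>

lemma obtain_realization_with_neighbourhood:
  assumes "realizes V d E" and fin: "finite V" and v: "v \<in> V"
    and W: "W \<subseteq> V - {v}" "card W = d v"
    and top: "\<And>w x. w \<in> W \<Longrightarrow> x \<in> V - W - {v} \<Longrightarrow> d x \<le> d w"
  obtains E' where "realizes V d E'" "E' `` {v} = W"
proof -
  define P where "P = realizes V d"
  define f where "f E' = card (E' `` {v} \<inter> W)" for E' :: "'a rel"
  have finW: "finite W" using W fin by (meson finite_Diff finite_subset)
  have fb: "\<forall>E'. P E' \<longrightarrow> f E' \<le> card W"
    unfolding f_def using finW by (auto intro: card_mono)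
  define E' where "E' = arg_max f P"
  have E': "P E'" "\<And>E''. P E'' \<Longrightarrow> f E'' \<le> f E'"
    using arg_max_nat_lemma[of P E f "Suc (card W)"] fb assms(1) unfolding E'_def P_def
    by (auto simp: less_Suc_eq_le)
  have R: "realizes V d E'" using E' by (simp add: P_def)
  note D = realizesD[OF R]
  have finI: "finite (E' `` {u})" for u
    using fin realizes_Image_subset[OF R] by (rule finite_subset[rotated])
  have sym: "\<And>a b. (a, b) \<in> E' \<Longrightarrow> (b, a) \<in> E'" using D(2) by (auto dest: symD)
  have irr: "\<And>a. (a, a) \<notin> E'" using D(3) by (auto simp: irrefl_def)
  have "W \<subseteq> E' `` {v}"
  proof (rule ccontr)
    assume "\<not> W \<subseteq> E' `` {v}"
    then obtain w where w: "w \<in> W" "(v, w) \<notin> E'" by auto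
    have "\<not> E' `` {v} \<subseteq> W"
      using card_subset_eq[OF finW, of "E' `` {v}"] D(4)[OF v] W(2) w by auto
    then obtain x where x: "(v, x) \<in> E'" "x \<notin> W" by auto
    have wV: "w \<in> V" "w \<noteq> v" and xV: "x \<in> V" "x \<noteq> v" using w x W D(1) irr by auto
    have "d x \<le> d w" using top w x xV by auto
    \<comment> \<open>A neighbour \<open>z\<close> of \<open>w\<close> that is not one of
      \<open>x\<close> is needed. Removing \<open>x\<close> and \<open>w\<close> discounts a
      possible edge between them; \<open>v\<close> lies only in the second set, so inclusion would
      force \<open>d w < d x\<close>.\<close>
    have "\<not> E' `` {w} - {x} \<subseteq> E' `` {x} - {w}"
    proof
      assume sub: "E' `` {w} - {x} \<subseteq> E' `` {x} - {w}"
      have "v \<in> E' `` {x} - {w}" "v \<notin> E' `` {w} - {x}" using x w sym wV by auto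
      with sub have "E' `` {w} - {x} \<subset> E' `` {x} - {w}" by auto
      then have "card (E' `` {w} - {x}) < card (E' `` {x} - {w})"
        using finI by (intro psubset_card_mono) auto
      moreover have "x \<in> E' `` {w} \<longleftrightarrow> w \<in> E' `` {x}" using sym by auto
      ultimately have "card (E' `` {w}) < card (E' `` {x})"
        using finI by (cases "x \<in> E' `` {w}") (auto simp: card_Diff_singleton card_gt_0_iff)
      then show False using D(4) wV xV \<open>d x \<le> d w\<close> by simp
    qed
    then obtain z where z: "(w, z) \<in> E'" "z \<noteq> x" "(x, z) \<notin> E' \<or> z = w" by auto
    then have z': "(x, z) \<notin> E'" using irr by auto
    define E2 where "E2 = E' - {(v, x), (x, v), (w, z), (z, w)} \<union> {(v, w), (w, v), (x, z), (z, x)}"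
    have "P E2" unfolding P_def E2_def
      using realizes_swap[OF R fin, of v x w z] x w z z' wV by auto
    moreover have "E2 `` {v} \<inter> W = insert w (E' `` {v} \<inter> W)"
      using x w z z' sym xV wV unfolding E2_def by auto
    then have "f E2 > f E'" unfolding f_def using w finI by (simp add: card_insert_disjoint)
    ultimately show False using E'(2) by fastforce
  qed
  then have "E' `` {v} = W"
    using card_subset_eq[OF finI, of W v] D(4)[OF v] W(2) by auto
  then show ?thesis using that R by blast
qed

lemma realizes_delete_vertex:
  assumes R: "realizes V d E" and "finite V" "v \<in> V"
  shows "realizes (V - {v}) (\<lambda>x. d x - of_bool (x \<in> E `` {v})) (E \<inter> (V - {v}) \<times> (V - {v}))"
proof -
  note D = realizesD[OF R]
  have sym: "\<And>a b. (a, b) \<in> E \<Longrightarrow> (b, a) \<in> E" using D(2) by (auto dest: symD)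
  have "card ((E \<inter> (V - {v}) \<times> (V - {v})) `` {x}) = d x - of_bool (x \<in> E `` {v})"
    if "x \<in> V - {v}" for x
  proof -
    have "(E \<inter> (V - {v}) \<times> (V - {v})) `` {x} = E `` {x} - {v}" using that D(1) by auto
    then show ?thesis
      using D(4)[of x] that sym by (auto simp: card_Diff_singleton_if)
  qed
  then show ?thesis
    using D sym by (auto simp: realizes_def irrefl_def intro!: symI)
qed

lemma realizes_add_vertex:
  assumes R: "realizes V e E" and "finite V" "v \<notin> V" "W \<subseteq> V" "card W = d v"
    and d: "\<And>x. x \<in> V \<Longrightarrow> d x = e x + of_bool (x \<in> W)"
  shows "realizes (insert v V) d (E \<union> {v} \<times> W \<union> W \<times> {v})" (is "realizes _ _ ?E'")
proof -
  note D = realizesD[OF R]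
  have "?E' `` {v} = W" using D(1) assms(3,4) by auto
  moreover have "card (?E' `` {x}) = d x" if x: "x \<in> V" for x
  proof (cases "x \<in> W")
    case True
    have "?E' `` {x} = insert v (E `` {x})" using True assms(3) x by auto
    moreover have "v \<notin> E `` {x}" "finite (E `` {x})"
      using D(1) assms(2,3) by (auto intro: finite_subset[of _ V])
    ultimately show ?thesis using True d[OF x] D(4)[OF x] by simp
  next
    case False
    have "?E' `` {x} = E `` {x}" using False assms(3) x by auto
    then show ?thesis using False d[OF x] D(4)[OF x] by simp
  qed
  ultimately show ?thesis
    using D assms(3-5) by (auto simp: realizes_def irrefl_def sym_def)
qed

section \<open>Realizability of flat degree sequences\<close>

lemma subset_between_with_card:
  assumes "finite B" "A \<subseteq> B" "card A \<le> m" "m \<le> card B"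
  obtains W where "A \<subseteq> W" "W \<subseteq> B" "card W = m"
  using exists_subset_between[OF assms(3,4,2,1)] by blast

text \<open>Positivity on \<open>W\<close> keeps the truncated subtraction exact; this is the
  bookkeeping for removing one edge at each vertex of \<open>W\<close>.\<close>

lemma sum_diff_of_bool:
  fixes d :: "'a \<Rightarrow> nat"
  assumes "finite R" "W \<subseteq> R" "\<And>x. x \<in> W \<Longrightarrow> d x > 0"
  shows "(\<Sum>x\<in>R. d x - of_bool (x \<in> W)) + card W = sum d R"
proof -
  have "sum d R = (\<Sum>x\<in>R. (d x - of_bool (x \<in> W)) + of_bool (x \<in> W))"
    using assms by (intro sum.cong) fastforce+
  also have "\<dots> = (\<Sum>x\<in>R. d x - of_bool (x \<in> W)) + card W"
    using assms by (simp add: sum.distrib Int_absorb1)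
  finally show ?thesis ..
qed

text \<open>
  Delete a vertex of maximum degree and lower the degrees of \<open>t\<close> of the largest
  remaining vertices: the hypothesis survives with the bound \<open>t\<close> or \<open>t - 1\<close>.
\<close>

lemma near_regular_realizable:
  fixes e :: "'a \<Rightarrow> nat"
  assumes "finite R" "\<And>x. x \<in> R \<Longrightarrow> e x \<le> t"
    and "card {x \<in> R. t \<le> e x + 1} \<ge> t + 1" "even (sum e R)"
  shows "\<exists>E. realizes R e E"
  using assms
proof (induction "card R + t" arbitrary: R e t rule: less_induct)
  case less
  note fin = less.prems(1)
  \<comment> \<open>If no vertex reaches \<open>t\<close>, the level drops to \<open>t - 1\<close>
    on the same set, which is why \<open>t\<close> enters the induction measure.\<close>
  consider "t = 0" | "t > 0" "\<forall>x\<in>R. e x \<noteq> t" | v where "t > 0" "v \<in> R" "e v = t" by blast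
  then show ?case
  proof cases
    case 1
    then show ?thesis using less.prems by (intro exI[of _ "{}"]) (auto simp: realizes_def irrefl_def sym_def)
  next
    case 2
    have "card {x \<in> R. t \<le> e x + 1} \<le> card {x \<in> R. t - 1 \<le> e x + 1}"
      using fin by (intro card_mono) auto
    moreover have "e x \<le> t - 1" if "x \<in> R" for x using less.prems(2)[OF that] 2 that by fastforce
    ultimately show ?thesis using 2 less.prems by (intro less.hyps[of R "t - 1"]) auto
  next
    case 3
    define A where "A = {x \<in> R - {v}. e x = t}"
    define B where "B = {x \<in> R - {v}. t \<le> e x + 1}"
    have finAB: "finite A" "finite B" "finite (R - {v})" using fin by (auto simp: A_def B_def)
    have "{x \<in> R. t \<le> e x + 1} = insert v B" "v \<notin> B" using 3 by (auto simp: B_def)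
    then have cB: "card B \<ge> t" using less.prems(3) finAB by simp
    have AB: "A \<subseteq> B" by (auto simp: A_def B_def)
    \<comment> \<open>With \<open>A\<close> empty, \<open>v\<close> would be the only vertex of odd
      degree, against the parity of the sum.\<close>
    have t1: "t = 1 \<Longrightarrow> A \<noteq> {}"
    proof
      assume t: "t = 1" "A = {}"
      have "sum e R = e v + sum e (R - {v})" using 3 fin by (simp add: sum.remove)
      moreover have "sum e (R - {v}) = 0" using t less.prems(2) fin
        by (intro sum.neutral) (force simp: A_def le_Suc_eq)
      ultimately show False using less.prems(4) 3 t by simp
    qed
    \<comment> \<open>Neighbours of \<open>v\<close> are taken from degree \<open>t\<close> first,
      then from \<open>t - 1\<close>. For \<open>t = 1\<close> the second kind has degree 0 and
      cannot lose an edge, so only \<open>A\<close> may be used.\<close>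
    obtain W where W: "W \<subseteq> R - {v}" "card W = t" "\<And>x. x \<in> W \<Longrightarrow> e x > 0"
      and W': "(W \<subset> A) \<or> (A \<subseteq> W \<and> W \<subseteq> B)"
    proof (cases "t < card A")
      case True
      then obtain W where "W \<subseteq> A" "card W = t"
        using obtain_subset_with_card_n[of t A] by auto
      then show ?thesis using True 3 by (intro that[of W]) (auto simp: A_def)
    next
      case False
      then obtain W where w: "A \<subseteq> W" "W \<subseteq> B" "card W = t"
        using subset_between_with_card[of B A t] finAB AB cB by auto
      have "e x > 0" if "x \<in> W" for x
      proof (cases "t = 1")
        case True
        then have "card A \<ge> 1" using t1 finAB by (simp add: Suc_le_eq card_gt_0_iff)
        then have "A = W" using w True finAB by (intro card_seteq) (auto intro: finite_subset)
        then show ?thesis using that 3 by (auto simp: A_def)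
      next
        case False
        then show ?thesis using that w 3 by (auto simp: B_def)
      qed
      then show ?thesis using w by (intro that[of W]) (auto simp: B_def)
    qed
    define e' where "e' x = e x - of_bool (x \<in> W)" for x
    \<comment> \<open>The level stays at \<open>t\<close> only if some vertex of degree
      \<open>t\<close> is left over; then \<open>A\<close> alone has more than \<open>t\<close>
      elements.\<close>
    define t' where "t' = (if W \<subset> A then t else t - 1)"
    have s: "sum e' (R - {v}) + t = sum e (R - {v})"
      unfolding e'_def using sum_diff_of_bool[of "R - {v}" W e] W finAB by simp
    have "sum e R = t + sum e (R - {v})" using 3 fin by (simp add: sum.remove)
    then have ev: "even (sum e' (R - {v}))" using s less.prems(4) by (metis even_add)
    have le: "e' x \<le> t'" if "x \<in> R - {v}" for x
      using that less.prems(2)[of x] W' unfolding e'_def t'_def A_def by auto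
    have "B \<subseteq> {x \<in> R - {v}. t' \<le> e' x + 1}"
      using W' unfolding B_def e'_def t'_def A_def by auto
    then have cB': "card B \<le> card {x \<in> R - {v}. t' \<le> e' x + 1}"
      using finAB by (intro card_mono) auto
    have "t' + 1 \<le> card B"
    proof (cases "W \<subset> A")
      case True
      then have "t < card A" using W finAB psubset_card_mono by metis
      then show ?thesis using card_mono[OF finAB(2) AB] True by (simp add: t'_def)
    qed (use cB 3 in \<open>simp add: t'_def\<close>)
    then have c: "t' + 1 \<le> card {x \<in> R - {v}. t' \<le> e' x + 1}" using cB' by simp
    have "card (R - {v}) < card R" using 3 fin by (intro card_Diff1_less) auto
    moreover have "t' \<le> t" by (simp add: t'_def)
    ultimately have "\<exists>E. realizes (R - {v}) e' E"
      using le c ev finAB by (intro less.hyps[of "R - {v}" t']) auto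
    then obtain E where E: "realizes (R - {v}) e' E" by blast
    have "realizes (insert v (R - {v})) e (E \<union> {v} \<times> W \<union> W \<times> {v})"
    proof (rule realizes_add_vertex[OF E])
      show "e x = e' x + of_bool (x \<in> W)" for x
        using W(3)[of x] by (cases "x \<in> W") (auto simp: e'_def)
    qed (use W 3 finAB in auto)
    then show ?thesis using 3 by (metis insert_Diff)
  qed
qed

text \<open>The vertices of \<open>S\<close> are served one by one, each taking outer vertices from
  the current top levels \<open>t\<close> and \<open>t - 1\<close>. The invariant is that the excess
  over \<open>\<tau>\<close> does not exceed the outstanding demand: once all are served, no degree
  exceeds \<open>\<tau>\<close> and \<open>near_regular_realizable\<close> finishes.\<close>

lemma distribute_and_realize:
  fixes d :: "'a \<Rightarrow> nat" and c :: "'b \<Rightarrow> nat"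
  assumes "finite S" "finite R"
    and "\<And>x. x \<in> R \<Longrightarrow> d x \<le> t"
    and "\<And>s. s \<in> S \<Longrightarrow> c s \<le> card {x \<in> R. t \<le> d x + 1}"
    and "sum c S \<le> sum d R" "even (sum d R + sum c S)"
    and "\<tau> \<le> t" "card {x \<in> R. \<tau> \<le> d x + 1} \<ge> \<tau> + 1" "(\<Sum>x\<in>R. d x - \<tau>) \<le> sum c S"
  shows "\<exists>W E. (\<forall>s\<in>S. W s \<subseteq> R \<and> card (W s) = c s) \<and>
           (\<forall>x\<in>R. card {s \<in> S. x \<in> W s} \<le> d x) \<and>
           realizes R (\<lambda>x. d x - card {s \<in> S. x \<in> W s}) E"
  using assms(1,3-)
proof (induction S arbitrary: d t \<tau> rule: finite_induct)
  case empty
  then have "d x \<le> \<tau>" if "x \<in> R" for x using that assms(2) by auto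
  then show ?case using near_regular_realizable[OF assms(2), of d \<tau>] empty by auto
next
  case (insert s S)
  define A where "A = {x \<in> R. d x = t}"
  define B where "B = {x \<in> R. t \<le> d x + 1}"
  have finAB: "finite A" "finite B" using assms(2) by (auto simp: A_def B_def)
  have AB: "A \<subseteq> B" by (auto simp: A_def B_def)
  have sumc: "sum c (insert s S) = c s + sum c S" using insert.hyps by simp
  have cs: "c s \<le> card B" using insert.prems(2)[of s] by (simp add: B_def)
  have t0: "t = 0 \<Longrightarrow> c s = 0" using insert.prems(1,3) sumc by simp
  \<comment> \<open>At level 1 the degree sum equals \<open>card A\<close>, so the demand fits into
    \<open>A\<close> and no vertex of degree 0 is asked for an edge.\<close>
  have t1: "t = 1 \<Longrightarrow> c s \<le> card A"
  proof -
    assume t: "t = 1"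
    have "sum d R = (\<Sum>x\<in>R. of_bool (x \<in> A))"
      using insert.prems(1) t by (intro sum.cong) (fastforce simp: A_def)+
    also have "\<dots> = card A" using assms(2) by (simp add: A_def Int_def)
    finally show ?thesis using insert.prems(3) sumc by simp
  qed
  obtain W where W: "W \<subseteq> R" "card W = c s" "\<And>x. x \<in> W \<Longrightarrow> d x > 0"
    and W': "(W \<subset> A) \<or> (t > 0 \<and> A \<subseteq> W \<and> W \<subseteq> B) \<or> (t = 0 \<and> W = {})"
  proof -
    consider "t = 0" | "t > 0" "c s < card A" | "t > 0" "c s \<ge> card A" by linarith
    then show ?thesis
    proof cases
      case 1
      then show ?thesis using t0 by (intro that[of "{}"]) auto
    next
      case 2
      then obtain W where "W \<subseteq> A" "card W = c s"
        using obtain_subset_with_card_n[of "c s" A] by auto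
      then show ?thesis using 2 by (intro that[of W]) (auto simp: A_def)
    next
      case 3
      then obtain W where w: "A \<subseteq> W" "W \<subseteq> B" "card W = c s"
        using subset_between_with_card[of B A "c s"] finAB AB cs by auto
      have "d x > 0" if "x \<in> W" for x
      proof (cases "t = 1")
        case True
        then have "A = W" using w t1 3 finAB by (intro card_seteq) (auto intro: finite_subset)
        then show ?thesis using that 3 by (auto simp: A_def)
      next
        case False
        then show ?thesis using that w 3 by (auto simp: B_def)
      qed
      then show ?thesis using w 3 by (intro that[of W]) (auto simp: B_def)
    qed
  qed
  define e where "e x = d x - of_bool (x \<in> W)" for x
  define t' where "t' = (if W \<subset> A then t else t - 1)"
  \<comment> \<open>\<open>\<tau>\<close> follows the top level down once \<open>t'\<close> falls
    below it; the excess is then zero.\<close>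
  define \<tau>' where "\<tau>' = min \<tau> t'"
  have s: "sum e R + c s = sum d R"
    unfolding e_def using sum_diff_of_bool[of R W d] W assms(2) by simp
  have le: "e x \<le> t'" if "x \<in> R" for x
    using that insert.prems(1)[of x] W' unfolding e_def t'_def A_def by auto
  have "B \<subseteq> {x \<in> R. t' \<le> e x + 1}"
    using W' unfolding B_def e_def t'_def A_def by auto
  then have cB': "card B \<le> card {x \<in> R. t' \<le> e x + 1}"
    using assms(2) by (intro card_mono) auto
  have "{x \<in> R. \<tau> \<le> d x + 1} \<subseteq> {x \<in> R. \<tau>' \<le> e x + 1}"
    using W' insert.prems(5) unfolding B_def e_def t'_def \<tau>'_def A_def by auto
  then have "card {x \<in> R. \<tau> \<le> d x + 1} \<le> card {x \<in> R. \<tau>' \<le> e x + 1}"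
    using assms(2) by (intro card_mono) auto
  then have c\<tau>: "\<tau>' + 1 \<le> card {x \<in> R. \<tau>' \<le> e x + 1}"
    using insert.prems(6) by (simp add: \<tau>'_def)
  have sum\<tau>: "(\<Sum>x\<in>R. e x - \<tau>') \<le> sum c S"
  proof (cases "\<tau>' = t'")
    case True
    then have "(\<Sum>x\<in>R. e x - \<tau>') = 0" using le by simp
    then show ?thesis by simp
  next
    case False
    then have \<tau>: "\<tau>' = \<tau>" "\<tau> < t'" by (auto simp: \<tau>'_def)
    \<comment> \<open>All of \<open>W\<close> lies above \<open>\<tau>\<close>, so the excess falls
      by exactly \<open>c s\<close>, just as the demand does.\<close>
    have "\<tau> < d x" if "x \<in> W" for x using that \<tau> W' by (auto simp: A_def B_def t'_def split: if_splits)
    then have "(\<Sum>x\<in>R. (d x - \<tau>) - of_bool (x \<in> W)) + card W = (\<Sum>x\<in>R. d x - \<tau>)"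
      using W assms(2) by (intro sum_diff_of_bool) auto
    moreover have "e x - \<tau>' = (d x - \<tau>) - of_bool (x \<in> W)" for x by (simp add: e_def \<tau>)
    ultimately show ?thesis using insert.prems(7) sumc W(2) by simp
  qed
  have "\<exists>W' E. (\<forall>s\<in>S. W' s \<subseteq> R \<and> card (W' s) = c s) \<and>
           (\<forall>x\<in>R. card {s \<in> S. x \<in> W' s} \<le> e x) \<and>
           realizes R (\<lambda>x. e x - card {s \<in> S. x \<in> W' s}) E"
  proof (rule insert.IH[OF le])
    show "c s' \<le> card {x \<in> R. t' \<le> e x + 1}" if "s' \<in> S" for s'
      using insert.prems(2)[of s'] that cB' by (simp add: B_def)
    show "sum c S \<le> sum e R" using insert.prems(3) sumc s by simp
    show "even (sum e R + sum c S)" using insert.prems(4) unfolding sumc s[symmetric] even_add by blast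
    show "\<tau>' \<le> t'" by (simp add: \<tau>'_def)
  qed (use c\<tau> sum\<tau> in auto)
  then obtain W2 E where W2: "\<And>s. s \<in> S \<Longrightarrow> W2 s \<subseteq> R \<and> card (W2 s) = c s"
    "\<And>x. x \<in> R \<Longrightarrow> card {s \<in> S. x \<in> W2 s} \<le> e x"
    "realizes R (\<lambda>x. e x - card {s \<in> S. x \<in> W2 s}) E" by blast
  define W3 where "W3 = W2(s := W)"
  have cd: "card {s' \<in> insert s S. x \<in> W3 s'} = card {s' \<in> S. x \<in> W2 s'} + of_bool (x \<in> W)" for x
  proof -
    have "{s' \<in> insert s S. x \<in> W3 s'} = (if x \<in> W then {s} else {}) \<union> {s' \<in> S. x \<in> W2 s'}"
      using insert.hyps by (auto simp: W3_def)
    then show ?thesis using insert.hyps by auto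
  qed
  have "\<forall>s'\<in>insert s S. W3 s' \<subseteq> R \<and> card (W3 s') = c s'"
    using W2(1) W by (auto simp: W3_def)
  moreover have "\<forall>x\<in>R. card {s' \<in> insert s S. x \<in> W3 s'} \<le> d x"
  proof
    fix x assume "x \<in> R"
    then show "card {s' \<in> insert s S. x \<in> W3 s'} \<le> d x"
      using W2(2)[of x] W(3)[of x] unfolding cd e_def by (cases "x \<in> W") auto
  qed
  moreover have "d x - card {s' \<in> insert s S. x \<in> W3 s'} = e x - card {s \<in> S. x \<in> W2 s}" for x
    unfolding cd e_def by (simp add: add.commute)
  then have "realizes R (\<lambda>x. d x - card {s' \<in> insert s S. x \<in> W3 s'}) E"
    using W2(3) by presburger
  ultimately show ?case by blast
qed

section \<open>Degree sums and prescribed near-cliques\<close>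

lemma sum_degrees_eq_card:
  assumes R: "realizes V d E" and "finite V" "A \<subseteq> V"
  shows "sum d A = card (E \<inter> A \<times> UNIV)"
proof -
  have fin: "finite A" "finite (E `` {v})" for v
    using finite_subset[OF assms(3,2)] finite_subset[OF realizes_Image_subset[OF R] assms(2)] by auto
  have "sum d A = (\<Sum>v\<in>A. card (E `` {v}))"
    using realizesD(4)[OF R] assms(3) by (intro sum.cong) auto
  also have "\<dots> = card (SIGMA v:A. E `` {v})" using fin by simp
  also have "(SIGMA v:A. E `` {v}) = E \<inter> A \<times> UNIV" by auto
  finally show ?thesis .
qed

text \<open>The easy direction of an Erdos--Gallai inequality, with the arcs inside \<open>K\<close>
  counted exactly: an arc leaving \<open>K\<close>, reversed, is counted by a degree
  outside.\<close>

lemma sum_degrees_le: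
  assumes R: "realizes V d E" and "finite V" "K \<subseteq> V"
  shows "sum d K \<le> card (E \<inter> K \<times> K) + sum d (V - K)"
proof -
  note D = realizesD[OF R]
  have sym: "\<And>a b. (a, b) \<in> E \<Longrightarrow> (b, a) \<in> E" using D(2) by (auto dest: symD)
  have finE: "finite E" using D(1) assms(2) by (auto intro: finite_subset)
  have "E \<inter> K \<times> UNIV = (E \<inter> K \<times> K) \<union> (E \<inter> K \<times> (V - K))" using D(1) by auto
  then have "sum d K \<le> card (E \<inter> K \<times> K) + card (E \<inter> K \<times> (V - K))"
    using sum_degrees_eq_card[OF assms] card_Un_le by metis
  moreover have "card (E \<inter> K \<times> (V - K)) = card ((E \<inter> K \<times> (V - K))\<inverse>)" by simp
  moreover have "card ((E \<inter> K \<times> (V - K))\<inverse>) \<le> card (E \<inter> (V - K) \<times> UNIV)"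
    using finE sym by (intro card_mono) auto
  ultimately show ?thesis using sum_degrees_eq_card[OF R assms(2) Diff_subset[of V K]]
    by linarith
qed

lemma degree_less_card:
  assumes R: "realizes V d E" and "finite V" "v \<in> V"
  shows "d v < card V"
proof -
  have "E `` {v} \<subset> V" using realizesD[OF R] assms(3) by (auto simp: irrefl_def)
  then show ?thesis using psubset_card_mono[OF assms(2)] realizesD(4)[OF R assms(3)] by metis
qed

lemma realizes_degree_pos:
  assumes R: "realizes V d E" and "finite V" "(x, y) \<in> E"
  shows "d x > 0"
proof -
  have "finite (E `` {x})" using finite_subset[OF realizes_Image_subset[OF R] assms(2)] .
  then have "card (E `` {x}) > 0" using assms(3) by (auto simp: card_gt_0_iff)
  moreover have "x \<in> V" using realizesD(1)[OF R] assms(3) by auto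
  ultimately show ?thesis using realizesD(4)[OF R] by simp
qed

text \<open>Handshake lemma by vertex deletion: removing \<open>v\<close> lowers the sum by
  \<open>2 * d v\<close>.\<close>

lemma even_sum_degrees:
  assumes "realizes V d E" "finite V"
  shows "even (sum d V)"
  using assms(2,1)
proof (induction V arbitrary: d E rule: finite_induct)
  case (insert v V)
  have "E `` {v} \<subseteq> V" using realizesD(1,3)[OF insert.prems] insert.hyps by (auto simp: irrefl_def)
  have pos: "d x > 0" if "x \<in> E `` {v}" for x
    using that insert.hyps(1) realizesD(2)[OF insert.prems]
    by (intro realizes_degree_pos[OF insert.prems, of x v]) (auto dest: symD)
  have "realizes V (\<lambda>x. d x - of_bool (x \<in> E `` {v})) (E \<inter> V \<times> V)"
    using realizes_delete_vertex[OF insert.prems, of v] insert.hyps by simp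
  then have "even (\<Sum>x\<in>V. d x - of_bool (x \<in> E `` {v}))" by (rule insert.IH)
  moreover have "(\<Sum>x\<in>V. d x - of_bool (x \<in> E `` {v})) + card (E `` {v}) = sum d V"
    using sum_diff_of_bool[OF insert.hyps(1) \<open>E `` {v} \<subseteq> V\<close> pos] .
  moreover have "card (E `` {v}) = d v" using realizesD(4)[OF insert.prems] by simp
  ultimately have "even (sum d V + d v)" by (metis add.assoc even_add)
  then show ?case using insert.hyps by (simp add: add.commute)
qed auto

text \<open>\<open>K\<close> is padded to exactly \<open>q\<close> vertices, so only an upper bound
  on its size has to be known. Serves to contradict a large degree sum.\<close>

lemma sum_le_two_levels:
  fixes d :: "'a \<Rightarrow> nat"
  assumes "finite V" "K \<subseteq> V" "card K \<le> q" "q \<le> card V" "m \<le> h"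
    and "\<And>v. v \<in> V \<Longrightarrow> d v \<le> h" "\<And>v. v \<in> V - K \<Longrightarrow> d v \<le> m"
  shows "sum d V \<le> q * h + (card V - q) * m"
proof -
  obtain Q where Q: "K \<subseteq> Q" "Q \<subseteq> V" "card Q = q"
    using subset_between_with_card[of V K q] assms by auto
  have "sum d V = sum d Q + sum d (V - Q)"
    using Q assms(1) by (metis add.commute sum.subset_diff)
  moreover have "sum d Q \<le> card Q * h"
    using Q assms(6) sum_bounded_above[of Q d h] by auto
  moreover have "sum d (V - Q) \<le> card (V - Q) * m"
    using Q assms(7) sum_bounded_above[of "V - Q" d m] by auto
  moreover have "card (V - Q) = card V - q"
    using Q assms(1) by (metis card_Diff_subset finite_subset)
  ultimately show ?thesis using Q by simp
qed

lemma card_offdiag: "finite S \<Longrightarrow> card (S \<times> S - Id) = card S * (card S - 1)"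
proof -
  assume "finite S"
  have "S \<times> S - Id = S \<times> S - (\<lambda>x. (x, x)) ` S" by auto
  moreover have "card ((\<lambda>x. (x, x)) ` S) = card S" by (intro card_image) (auto simp: inj_on_def)
  ultimately show ?thesis
    using \<open>finite S\<close> by (simp add: card_Diff_subset image_subset_iff diff_mult_distrib2 card_cartesian_product)
qed

text \<open>Three layers are glued: the clique on \<open>S\<close> without \<open>M\<close>, the
  edges from \<open>S\<close> to the sets \<open>W s\<close>, and \<open>F\<close> inside
  \<open>R\<close>. The degree equation on \<open>S\<close> is additive to avoid truncated
  subtraction.\<close>

lemma realizes_assemble:
  assumes fin: "finite S" "finite R" and disj: "S \<inter> R = {}"
    and M: "M \<subseteq> S \<times> S" "sym M" "irrefl M"
    and W: "\<And>s. s \<in> S \<Longrightarrow> W s \<subseteq> R"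
    and dS: "\<And>s. s \<in> S \<Longrightarrow> d s + 1 + card (M `` {s}) = card S + card (W s)"
    and dR: "\<And>x. x \<in> R \<Longrightarrow> card {s \<in> S. x \<in> W s} \<le> d x"
    and ER: "realizes R (\<lambda>x. d x - card {s \<in> S. x \<in> W s}) F"
  shows "realizes (S \<union> R) d ((S \<times> S - Id - M) \<union> Sigma S W \<union> (Sigma S W)\<inverse> \<union> F)" (is "realizes _ _ ?E")
proof -
  note D = realizesD[OF ER]
  have "card (?E `` {s}) = d s" if s: "s \<in> S" for s
  proof -
    have "?E `` {s} = (S - insert s (M `` {s})) \<union> W s"
      using s disj W D(1) by blast
    moreover have "card (S - insert s (M `` {s})) = card S - (card (M `` {s}) + 1)"
    proof -
      have sub: "insert s (M `` {s}) \<subseteq> S" using M s by auto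
      have "card (insert s (M `` {s})) = card (M `` {s}) + 1"
        using M(3) finite_subset[OF sub fin(1)] by (auto simp: irrefl_def)
      then show ?thesis using card_Diff_subset[OF finite_subset[OF sub fin(1)] sub] by simp
    qed
    moreover have "card (M `` {s}) + 1 \<le> card S"
    proof -
      have "M `` {s} \<subset> S" using M s by (auto simp: irrefl_def)
      then show ?thesis using psubset_card_mono[OF fin(1)] by (simp add: Suc_le_eq)
    qed
    moreover have "card ((S - insert s (M `` {s})) \<union> W s) = card (S - insert s (M `` {s})) + card (W s)"
      using fin W[OF s] disj by (intro card_Un_disjoint) (auto intro: finite_subset)
    ultimately show ?thesis using dS[OF s] by simp
  qed
  moreover have "card (?E `` {x}) = d x" if x: "x \<in> R" for x
  proof -
    have "?E `` {x} = {s \<in> S. x \<in> W s} \<union> F `` {x}"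
      using x disj W D(1) by blast
    moreover have "card ({s \<in> S. x \<in> W s} \<union> F `` {x}) = card {s \<in> S. x \<in> W s} + card (F `` {x})"
      using fin D(1) disj by (intro card_Un_disjoint) (auto intro: finite_subset)
    ultimately show ?thesis using D(4)[OF x] dR[OF x] by simp
  qed
  moreover have "sym ?E" using M(2) D(2) by (auto simp: sym_def)
  moreover have "irrefl ?E" using D(3) W disj by (auto simp: irrefl_def)
  moreover have "?E \<subseteq> (S \<union> R) \<times> (S \<union> R)" using D(1) W by auto
  ultimately show ?thesis by (auto simp: realizes_def)
qed

text \<open>With the edges inside \<open>S\<close> prescribed, \<open>s\<close> must still send
  \<open>c s\<close> edges outside. \<open>lower\<close> says that this number is not negative,
  \<open>upper\<close> that enough outer vertices lie near the top level, \<open>total\<close> that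
  the outer degrees suffice overall; \<open>distribute_and_realize\<close> does the rest.\<close>

lemma realize_with_near_clique:
  fixes d :: "'a \<Rightarrow> nat"
  assumes fin: "finite V" and S: "S \<subseteq> V" and ev: "even (sum d V)"
    and M: "M \<subseteq> S \<times> S" "sym M" "irrefl M"
    and le: "\<And>x. x \<in> V - S \<Longrightarrow> d x \<le> p"
    and lower: "\<And>s. s \<in> S \<Longrightarrow> card S \<le> d s + 1 + card (M `` {s})"
    and upper: "\<And>s. s \<in> S \<Longrightarrow> d s + 1 + card (M `` {s}) \<le> card S + card {x \<in> V - S. p \<le> d x + 1}"
    and total: "sum d S + card M \<le> card S * (card S - 1) + sum d (V - S)"
    and \<tau>: "\<tau> \<le> p" "card {x \<in> V - S. \<tau> \<le> d x + 1} \<ge> \<tau> + 1"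
      "(\<Sum>x\<in>V - S. d x - \<tau>) \<le> sum d S + card M - card S * (card S - 1)"
  shows "\<exists>E. realizes V d E \<and> S \<times> S - Id - M \<subseteq> E"
proof -
  define c where "c s = d s + 1 + card (M `` {s}) - card S" for s
  have finS: "finite S" "finite (V - S)" using fin S by (auto intro: finite_subset)
  have RM: "realizes S (\<lambda>s. card (M `` {s})) M" using M by (simp add: realizes_def)
  have "M \<inter> S \<times> UNIV = M" using M by auto
  then have cM: "(\<Sum>s\<in>S. card (M `` {s})) = card M"
    using sum_degrees_eq_card[OF RM finS(1) subset_refl] by simp
  \<comment> \<open>\<open>M\<close> is itself a graph on \<open>S\<close>, so its number of arcs is
    even; this carries the parity of \<open>sum d V\<close> over to the distribution.\<close>
  have evM: "even (card M)" using even_sum_degrees[OF RM finS(1)] cM by simp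
  have "(\<Sum>s\<in>S. c s + card S) = (\<Sum>s\<in>S. d s + 1 + card (M `` {s}))"
    using lower by (intro sum.cong) (auto simp: c_def)
  then have "sum c S + (\<Sum>s\<in>S. card S) = sum d S + (\<Sum>s\<in>S. 1) + card M"
    unfolding sum.distrib cM .
  then have "sum c S + card S * card S = sum d S + card S + card M" by simp
  moreover have "card S * card S = card S * (card S - 1) + card S"
    by (cases "card S") auto
  ultimately have sumc: "sum c S + card S * (card S - 1) = sum d S + card M" by simp
  have evS: "even (card S * (card S - 1))" by (cases "card S") auto
  have "sum d V = sum d S + sum d (V - S)"
    using S fin by (metis add.commute sum.subset_diff)
  then have evc: "even (sum d (V - S) + sum c S)"
    using ev evM evS sumc by (metis even_add)
  have "\<exists>W F. (\<forall>s\<in>S. W s \<subseteq> V - S \<and> card (W s) = c s) \<and>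
           (\<forall>x\<in>V - S. card {s \<in> S. x \<in> W s} \<le> d x) \<and>
           realizes (V - S) (\<lambda>x. d x - card {s \<in> S. x \<in> W s}) F"
  proof (rule distribute_and_realize[OF finS le])
    show "c s \<le> card {x \<in> V - S. p \<le> d x + 1}" if "s \<in> S" for s
      using upper[OF that] by (simp add: c_def)
    show "sum c S \<le> sum d (V - S)" using total sumc by linarith
    show "(\<Sum>x\<in>V - S. d x - \<tau>) \<le> sum c S" using \<tau>(3) sumc by linarith
  qed (use evc \<tau> in auto)
  then obtain W F where W: "\<And>s. s \<in> S \<Longrightarrow> W s \<subseteq> V - S" "\<And>s. s \<in> S \<Longrightarrow> card (W s) = c s"
    "\<And>x. x \<in> V - S \<Longrightarrow> card {s \<in> S. x \<in> W s} \<le> d x"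
    and F: "realizes (V - S) (\<lambda>x. d x - card {s \<in> S. x \<in> W s}) F" by blast
  let ?E = "(S \<times> S - Id - M) \<union> Sigma S W \<union> (Sigma S W)\<inverse> \<union> F"
  have "realizes (S \<union> (V - S)) d ?E"
  proof (rule realizes_assemble[OF finS _ M _ _ W(3) F])
    show "d s + 1 + card (M `` {s}) = card S + card (W s)" if "s \<in> S" for s
      using W(2)[OF that] lower[OF that] by (simp add: c_def)
  qed (use W in auto)
  moreover have "S \<union> (V - S) = V" using S by auto
  ultimately show ?thesis by (intro exI[of _ ?E]) auto
qed

section \<open>Near-cliques on the vertices of largest degree\<close>

text \<open>At most two edges are missing, adjacent or disjoint. Both patterns are parts of a path
  with two edges plus a disjoint edge, and the first fits on three vertices, where the induction
  starts.\<close>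

definition almost_complete :: "'a set \<Rightarrow> 'a rel \<Rightarrow> bool" where
  "almost_complete S E \<longleftrightarrow>
     (\<exists>a b c. {a, b, c} \<subseteq> S \<and> distinct [a, b, c] \<and>
        S \<times> S - Id - {(a, b), (b, a), (b, c), (c, b)} \<subseteq> E) \<or>
     (\<exists>a b c e. {a, b, c, e} \<subseteq> S \<and> distinct [a, b, c, e] \<and>
        S \<times> S - Id - {(a, b), (b, a), (c, e), (e, c)} \<subseteq> E)"

lemma almost_complete_pathI:
  "\<lbrakk>{a, b, c} \<subseteq> S; distinct [a, b, c]; S \<times> S - Id - {(a, b), (b, a), (b, c), (c, b)} \<subseteq> E\<rbrakk>
    \<Longrightarrow> almost_complete S E"
  unfolding almost_complete_def by blast

lemma almost_complete_matchingI:
  "\<lbrakk>{a, b, c, e} \<subseteq> S; distinct [a, b, c, e]; S \<times> S - Id - {(a, b), (b, a), (c, e), (e, c)} \<subseteq> E\<rbrakk>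
    \<Longrightarrow> almost_complete S E"
  unfolding almost_complete_def by blast

text \<open>A single missing edge extends to a missing path, while two missing edges are four
  missing arcs. The second alternative is the slack 4 that \<open>flat_high\<close> needs.\<close>

lemma almost_complete_or_card_le:
  assumes "finite S" "card S \<ge> 3" "sym E" "irrefl E"
  shows "almost_complete S E \<or> card (E \<inter> S \<times> S) + 4 \<le> card S * (card S - 1)"
proof -
  obtain T where "T \<subseteq> S" "card T = 3" using obtain_subset_with_card_n[OF assms(2)] by blast
  then obtain x y z where xyz: "{x, y, z} \<subseteq> S" "distinct [x, y, z]"
    by (auto simp: card_3_iff)
  show ?thesis
  proof (cases "\<exists>a b. a \<in> S \<and> b \<in> S \<and> a \<noteq> b \<and> (a, b) \<notin> E")
    case False
    then show ?thesis using xyz by (intro disjI1 almost_complete_pathI[of x y z]) auto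
  next
    case True
    then obtain a b where ab: "a \<in> S" "b \<in> S" "a \<noteq> b" "(a, b) \<notin> E" by blast
    show ?thesis
    proof (cases "S \<times> S - Id - {(a, b), (b, a)} \<subseteq> E")
      case True
      obtain c where "c \<in> S" "c \<noteq> a" "c \<noteq> b" using xyz by auto
      moreover have "S \<times> S - Id - {(a, b), (b, a), (b, c), (c, b)} \<subseteq> E" using True by blast
      ultimately have "almost_complete S E" using ab by (intro almost_complete_pathI) auto
      then show ?thesis ..
    next
      case False
      then obtain c e where ce: "c \<in> S" "e \<in> S" "c \<noteq> e" "(c, e) \<notin> E" "(c, e) \<noteq> (a, b)" "(c, e) \<noteq> (b, a)"
        by auto
      let ?X = "{(a, b), (b, a), (c, e), (e, c)}"
      have "(b, a) \<notin> E" "(e, c) \<notin> E" using ab ce assms(3) by (auto dest: symD)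
      then have "E \<inter> S \<times> S \<subseteq> S \<times> S - Id - ?X" using ab ce assms(4) by (auto simp: irrefl_def)
      then have "card (E \<inter> S \<times> S) \<le> card (S \<times> S - Id - ?X)" using assms(1) by (intro card_mono) auto
      also have "\<dots> = card (S \<times> S - Id) - card ?X" using ab ce assms(1) by (intro card_Diff_subset) auto
      also have "card ?X = 4" using ab ce by auto
      finally have "card (E \<inter> S \<times> S) \<le> card S * (card S - 1) - 4" using card_offdiag[OF assms(1)] by simp
      \<comment> \<open>At least six off-diagonal pairs exist, so subtracting 4 was not
        truncated.\<close>
      moreover have "3 * 2 \<le> card S * (card S - 1)" using assms(2) by (intro mult_le_mono) auto
      ultimately have "card (E \<inter> S \<times> S) + 4 \<le> card S * (card S - 1)" by linarith
      then show ?thesis ..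
    qed
  qed
qed

text \<open>
  Take the largest level \<open>\<tau>\<close> with more than \<open>\<tau>\<close> outer vertices of degree at least \<open>\<tau> - 1\<close>.
  If \<open>\<tau> > k\<close>, the edges leaving \<open>S\<close> suffice to lower all outer degrees to \<open>\<tau>\<close>; if \<open>\<tau> \<le> k\<close>,
  all degrees are at most \<open>2 * k + 1\<close> and few exceed \<open>k - 1\<close>, so the degree sum is too small
  for \<open>n \<ge> 4 * k + 14\<close> (only \<open>k = 2\<close> needs a separate computation).
\<close>

lemma flattening_level_exists:
  fixes d :: "'a \<Rightarrow> nat"
  assumes fin: "finite V" and S: "S \<subseteq> V" "card S = k + 2" and k: "k \<ge> 2" and n: "card V \<ge> 4 * k + 14"
    and sum: "(k - 1) * (2 * card V - k) + 2 \<le> sum d V"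
    and le: "\<And>x. x \<in> V - S \<Longrightarrow> d x \<le> p" and ge: "\<And>s. s \<in> S \<Longrightarrow> p \<le> d s" and pk: "k \<le> p"
    and h: "\<And>v. v \<in> V \<Longrightarrow> d v \<le> h" "h \<le> k + card {x \<in> V - S. d x = p}"
  shows "\<exists>\<tau>\<le>p. card {x \<in> V - S. \<tau> \<le> d x + 1} \<ge> \<tau> + 1 \<and>
           (\<Sum>x\<in>V - S. d x - \<tau>) \<le> sum d S + 4 - (k + 2) * (k + 1)"
proof -
  define R where "R = V - S"
  define g where "g \<tau> = card {x \<in> R. \<tau> \<le> d x + 1}" for \<tau>
  have finR: "finite R" "finite S" using fin S by (auto simp: R_def intro: finite_subset)
  have cR: "card R = card V - (k + 2)" using S finR by (simp add: R_def card_Diff_subset)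
  show ?thesis
  proof (cases "p + 1 \<le> g p")
    case True
    then show ?thesis using le by (intro exI[of _ p]) (simp add: g_def R_def)
  next
    case False
    \<comment> \<open>Level 0 qualifies since its set is all of \<open>R\<close>. As
      \<open>p\<close> itself fails, the greatest such level is a true threshold:
      \<open>g (\<tau> + 1) \<le> \<tau> + 1\<close>.\<close>
    define P where "P \<tau> \<longleftrightarrow> \<tau> < p \<and> \<tau> + 1 \<le> g \<tau>" for \<tau>
    have "P 0" using cR n k pk by (simp add: P_def g_def)
    define \<tau> where "\<tau> = Greatest P"
    have P\<tau>: "P \<tau>" unfolding \<tau>_def
      using GreatestI_nat[of P 0 p] \<open>P 0\<close> by (simp add: P_def)
    have "\<not> P (\<tau> + 1)"
    proof
      assume "P (\<tau> + 1)"
      then have "\<tau> + 1 \<le> \<tau>" unfolding \<tau>_def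
        using Greatest_le_nat[of P "Greatest P + 1" p] by (auto simp: P_def)
      then show False by simp
    qed
    then have g1: "g (\<tau> + 1) \<le> \<tau> + 1" using False P\<tau> by (cases "\<tau> + 1 = p") (auto simp: P_def)
    \<comment> \<open>This is the set counted by \<open>g (\<tau> + 1)\<close>. All outer vertices
      above \<open>\<tau>\<close> belong to it, in particular those of degree \<open>p\<close>, so
      its size bounds \<open>h\<close>.\<close>
    define A where "A = {x \<in> R. \<tau> \<le> d x}"
    have A: "card A \<le> \<tau> + 1" "A \<subseteq> R" "finite A" using g1 finR by (auto simp: A_def g_def)
    have "card {x \<in> V - S. d x = p} \<le> card A"
      using P\<tau> finR by (intro card_mono) (auto simp: A_def R_def P_def)
    then have hA: "h \<le> k + card A" using h(2) by simp
    have "S \<noteq> {}" using S k by auto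
    then have ph: "p \<le> h" using ge h(1) S by (meson ex_in_conv le_trans subsetD)
    have "(\<Sum>x\<in>R. d x - \<tau>) = (\<Sum>x\<in>A. d x - \<tau>)"
      using finR by (intro sum.mono_neutral_right) (auto simp: A_def)
    also have "\<dots> \<le> card A * (p - \<tau>)"
      using sum_bounded_above[of A "\<lambda>x. d x - \<tau>" "p - \<tau>"] le A by (force simp: R_def diff_le_mono)
    finally have excess: "(\<Sum>x\<in>R. d x - \<tau>) \<le> card A * (p - \<tau>)" .
    have sumS: "(k + 2) * p \<le> sum d S" using sum_bounded_below[of S p d] ge S by simp
    have "card A * (p - \<tau>) \<le> sum d S + 4 - (k + 2) * (k + 1)"
    proof (cases "k + 1 \<le> \<tau>")
      case True
      \<comment> \<open>With \<open>\<tau> = k + 1 + i\<close> and \<open>p = \<tau> + j\<close> the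
        demand is at least \<open>(k + 2) * (i + j)\<close> and the excess at most
        \<open>(k + 2 + i) * j\<close>, so \<open>j \<le> k + 2\<close> decides.\<close>
      then obtain i where i: "\<tau> = k + 1 + i" using le_Suc_ex by blast
      obtain j where j: "p = \<tau> + j" using P\<tau> by (metis P_def less_imp_le le_Suc_ex)
      have "card A * j \<le> (k + 2 + i) * j" using A i by (intro mult_right_mono) auto
      moreover have "j \<le> k + 2" using ph hA A j by linarith
      then have "i * j \<le> i * (k + 2)" by (intro mult_left_mono) auto
      ultimately have "card A * j + (k + 2) * (k + 1) \<le> (k + 2) * p"
        unfolding j i by (simp add: algebra_simps)
      then show ?thesis using sumS j by simp
    next
      case False
      define K where "K = S \<union> A"
      have K: "K \<subseteq> V" "card K \<le> k + 2 + card A"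
        using S A card_Un_le[of S A] by (auto simp: K_def R_def)
      have out: "d v < \<tau>" if "v \<in> V - K" for v using that by (auto simp: K_def A_def R_def)
      obtain m where m: "card V = 4 * k + 14 + m" using n le_Suc_ex by blast
      \<comment> \<open>For \<open>k = 2\<close> the count of the first case refutes only more than
        28 vertices, while 22 are guaranteed; with \<open>p \<ge> 3\<close> the excess is compared
        with \<open>4 * p - 8\<close> directly.\<close>
      consider "k \<ge> 3" | "k = 2" "p = 2" | "k = 2" "p \<ge> 3" using k pk by linarith
      then show ?thesis
      proof cases
        case 1
        have "sum d V \<le> (2 * k + 3) * (2 * k + 1) + (card V - (2 * k + 3)) * (k - 1)"
        proof (rule sum_le_two_levels[OF fin K(1)])
          show "d v \<le> 2 * k + 1" if "v \<in> V" for v using h(1)[OF that] hA A False by linarith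
          show "d v \<le> k - 1" if "v \<in> V - K" for v using out[OF that] False by linarith
        qed (use K A False n in auto)
        moreover obtain i where "k = 3 + i" using 1 le_Suc_ex by blast
        ultimately have False using sum m by (simp add: algebra_simps)
        then show ?thesis ..
      next
        case 2
        then have \<tau>: "\<tau> \<le> 1" using P\<tau> by (auto simp: P_def)
        have "sum d V \<le> 6 * 4 + (card V - 6) * 0"
        proof (rule sum_le_two_levels[OF fin K(1)])
          show "d v \<le> 4" if "v \<in> V" for v using h(1)[OF that] hA A 2 \<tau> by linarith
          show "d v \<le> 0" if "v \<in> V - K" for v using out[OF that] \<tau> by linarith
        qed (use K A 2 \<tau> n in auto)
        then have False using sum m 2 by simp
        then show ?thesis ..
      next
        case 3
        have "card A * (p - \<tau>) \<le> (\<tau> + 1) * (p - \<tau>)" using A by (intro mult_right_mono) auto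
        also have "\<dots> \<le> 4 * p - 8"
        proof -
          have "p \<le> \<tau> + 3" "\<tau> < p" using ph hA A 3 P\<tau> by (auto simp: P_def)
          moreover have "\<tau> = 0 \<or> \<tau> = 1 \<or> \<tau> = 2" using False 3 by auto
          ultimately show ?thesis using 3(2) by (auto simp: algebra_simps diff_mult_distrib2)
        qed
        finally show ?thesis using sumS 3 by simp
      qed
    qed
    then show ?thesis using excess P\<tau> by (intro exI[of _ \<tau>]) (auto simp: P_def g_def R_def)
  qed
qed

text \<open>A vertex of \<open>S\<close> of degree \<open>k\<close> cannot be joined to all
  \<open>k + 1\<close> others, so it must meet a missing edge. There are at most four such vertices,
  and a missing matching covers four. If \<open>E\<close> already works nothing has to be done;
  otherwise its four missing arcs give \<open>total\<close>.\<close>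

lemma flat_high:
  fixes d :: "'a \<Rightarrow> nat"
  assumes real: "realizes V d E" and fin: "finite V"
    and S: "S \<subseteq> V" "card S = k + 2" and k: "k \<ge> 2" and n: "card V \<ge> 4 * k + 14"
    and sum: "(k - 1) * (2 * card V - k) + 2 \<le> sum d V"
    and le: "\<And>x. x \<in> V - S \<Longrightarrow> d x \<le> p" and ge: "\<And>s. s \<in> S \<Longrightarrow> p \<le> d s"
    and z: "z \<in> S" "d z = p" and pk: "k \<le> p"
    and h: "\<And>v. v \<in> V \<Longrightarrow> d v \<le> h" "h \<le> k + card {x \<in> V - S. d x = p}"
  shows "\<exists>E'. realizes V d E' \<and> almost_complete S E'"
proof (cases "almost_complete S E")
  case True
  then show ?thesis using real by blast
next
  case False
  have finS: "finite S" using S fin by (auto intro: finite_subset)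
  have "card (E \<inter> S \<times> S) + 4 \<le> (k + 2) * (k + 1)"
    using almost_complete_or_card_le[OF finS _ realizesD(2,3)[OF real]] False S k by simp
  then have total: "sum d S + 4 \<le> (k + 2) * (k + 1) + sum d (V - S)"
    using sum_degrees_le[OF real fin S(1)] by linarith
  \<comment> \<open>Five such vertices would force \<open>p \<le> k\<close> and leave at most
    \<open>k - 3\<close> vertices of degree above \<open>k\<close>.\<close>
  have low: "card {s \<in> S. d s \<le> k} \<le> 4"
  proof (rule ccontr)
    assume neg: "\<not> ?thesis"
    define K where "K = {v \<in> V. k < d v}"
    have out: "d v \<le> k" if "v \<in> V - K" for v using that by (auto simp: K_def)
    have "{s \<in> S. d s \<le> k} \<noteq> {}" using neg by (metis card.empty zero_le)
    then have "p \<le> k" using ge by fastforce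
    then have "K \<subseteq> S - {s \<in> S. d s \<le> k}" using le by (force simp: K_def)
    then have "card K \<le> card (S - {s \<in> S. d s \<le> k})" using finS by (intro card_mono) auto
    also have "\<dots> = card S - card {s \<in> S. d s \<le> k}" using finS by (intro card_Diff_subset) auto
    finally have cK: "card K + 3 \<le> k" using neg S card_mono[of S "{s \<in> S. d s \<le> k}"] finS by auto
    have "sum d V \<le> (k - 3) * (card V - 1) + (card V - (k - 3)) * k"
    proof (rule sum_le_two_levels[OF fin, of K])
      show "d v \<le> card V - 1" if "v \<in> V" for v using degree_less_card[OF real fin that] by simp
    qed (use cK n out in \<open>auto simp: K_def\<close>)
    moreover obtain m where "card V = 4 * k + 14 + m" using n le_Suc_ex by blast
    moreover obtain i where "k = 3 + i" using cK le_Suc_ex by (metis add.commute add_leD2)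
    ultimately show False using sum by (simp add: algebra_simps)
  qed
  obtain Y where Y: "{s \<in> S. d s \<le> k} \<subseteq> Y" "Y \<subseteq> S" "card Y = 4"
    using subset_between_with_card[OF finS _ low] S k by auto
  then have "finite Y" using finS by (auto intro: finite_subset)
  then obtain ys where ys: "set ys = Y" "distinct ys" using finite_distinct_list by blast
  then have "length ys = 4" using Y distinct_card by metis
  then obtain a b c e where "ys = [a, b, c, e]" by (auto simp: numeral_eq_Suc length_Suc_conv)
  then have abce: "Y = {a, b, c, e}" "distinct [a, b, c, e]" using ys by auto
  define M where "M = {(a, b), (b, a), (c, e), (e, c)}"
  have M: "M \<subseteq> S \<times> S" "sym M" "irrefl M" "card M = 4"
    using abce Y by (auto simp: M_def sym_def irrefl_def)
  have MY: "card (M `` {s}) = of_bool (s \<in> Y)" for s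
  proof -
    have "M `` {s} = (if s = a then {b} else if s = b then {a} else if s = c then {e} else if s = e then {c} else {})"
      using abce by (auto simp: M_def)
    then show ?thesis using abce by auto
  qed
  obtain \<tau> where \<tau>: "\<tau> \<le> p" "card {x \<in> V - S. \<tau> \<le> d x + 1} \<ge> \<tau> + 1"
    "(\<Sum>x\<in>V - S. d x - \<tau>) \<le> sum d S + 4 - (k + 2) * (k + 1)"
    using flattening_level_exists[OF fin S k n sum le ge pk h] by blast
  have "card {x \<in> V - S. d x = p} \<le> card {x \<in> V - S. p \<le> d x + 1}"
    using fin by (intro card_mono) auto
  then have hB: "h \<le> k + card {x \<in> V - S. p \<le> d x + 1}" using h(2) by simp
  have "\<exists>E'. realizes V d E' \<and> S \<times> S - Id - M \<subseteq> E'"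
  proof (rule realize_with_near_clique[OF fin S(1) even_sum_degrees[OF real fin] M(1-3) le _ _ _ \<tau>(1,2)])
    show "card S \<le> d s + 1 + card (M `` {s})" if s: "s \<in> S" for s
    proof (cases "s \<in> Y")
      case True
      then show ?thesis using ge[OF s] pk S MY[of s] by simp
    next
      case False
      then have "k < d s" using Y s by auto
      then show ?thesis using S by simp
    qed
    show "d s + 1 + card (M `` {s}) \<le> card S + card {x \<in> V - S. p \<le> d x + 1}" if "s \<in> S" for s
      using h(1)[of s] that S hB MY[of s] by auto
  qed (use total \<tau>(3) M S in auto)
  then show ?thesis
    using almost_complete_matchingI[of a b c e S] abce Y unfolding M_def by metis
qed

text \<open>Here \<open>z\<close> has degree \<open>k - 1\<close>, two less than a clique on
  \<open>S\<close> demands, so the missing edges form a path with centre \<open>z\<close>. Its ends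
  cover the vertices of degree \<open>k\<close> in \<open>S\<close>, of which there are at most two;
  \<open>z\<close> gets no neighbour outside \<open>S\<close>.\<close>

lemma flat_low:
  fixes d :: "'a \<Rightarrow> nat"
  assumes real: "realizes V d E" and fin: "finite V"
    and S: "S \<subseteq> V" "card S = k + 2" and k: "k \<ge> 2" and n: "card V \<ge> 4 * k + 14"
    and sum: "(k - 1) * (2 * card V - k) + 2 \<le> sum d V"
    and le: "\<And>x. x \<in> V - S \<Longrightarrow> d x \<le> k - 1"
    and z: "z \<in> S" "d z = k - 1"
    and h: "\<And>v. v \<in> V \<Longrightarrow> d v \<le> h" "h \<le> k + card {x \<in> V - S. d x = k - 1}"
  shows "\<exists>E'. realizes V d E' \<and> almost_complete S E'"
proof -
  define S' where "S' = S - {z}"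
  have finS: "finite S" "finite S'" using S fin by (auto intro: finite_subset simp: S'_def)
  have S': "S' \<subseteq> V" "card S' = k + 1" "S = insert z S'" "z \<notin> S'"
    using S z finS by (auto simp: S'_def)
  obtain m where m: "card V = 4 * k + 14 + m" using n le_Suc_ex by blast
  obtain i where i: "k = 2 + i" using k le_Suc_ex by blast
  have cE: "card (E \<inter> K \<times> K) \<le> card K * (card K - 1)" if "K \<subseteq> V" for K
  proof -
    have "finite K" using that fin finite_subset by blast
    moreover have "E \<inter> K \<times> K \<subseteq> K \<times> K - Id" using realizesD(3)[OF real] by (auto simp: irrefl_def)
    ultimately show ?thesis using card_offdiag[of K] card_mono[of "K \<times> K - Id" "E \<inter> K \<times> K"] by auto
  qed
  have split: "sum d V = sum d K + sum d (V - K)" "card (V - K) = card V - card K"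
    if "K \<subseteq> V" for K
    using that fin by (metis add.commute sum.subset_diff, metis card_Diff_subset finite_subset)
  have out: "d v \<le> k - 1" if "v \<in> V - S'" for v using that le z S' by (cases "v = z") auto
  \<comment> \<open>The sharp point: a second vertex of degree below \<open>k\<close> in
    \<open>S\<close> would bound the sum by \<open>(k - 1) * (2 * card V - k)\<close>, the degree
    sum of the extremal join.\<close>
  have S'k: "k \<le> d s" if s: "s \<in> S'" for s
  proof (rule ccontr)
    assume neg: "\<not> k \<le> d s"
    let ?K = "S' - {s}"
    have K: "?K \<subseteq> V" "card ?K = k" using S' s finS by auto
    have "d v \<le> k - 1" if "v \<in> V - ?K" for v using out[of v] neg that by (cases "v = s") auto
    then have "sum d (V - ?K) \<le> (card V - k) * (k - 1)"
      using sum_bounded_above[of "V - ?K" d "k - 1"] split(2)[OF K(1)] K(2) by auto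
    moreover have "sum d ?K \<le> k * (k - 1) + sum d (V - ?K)"
      using sum_degrees_le[OF real fin K(1)] cE[OF K(1)] K(2) by simp
    ultimately have "sum d V \<le> k * (k - 1) + 2 * ((card V - k) * (k - 1))"
      using split(1)[OF K(1)] by linarith
    then show False using sum unfolding m i by (simp add: algebra_simps)
  qed
  have low: "card {s \<in> S'. d s \<le> k} \<le> 2"
  proof (rule ccontr)
    assume neg: "\<not> ?thesis"
    then obtain X where X: "X \<subseteq> {s \<in> S'. d s \<le> k}" "card X = 3"
      using obtain_subset_with_card_n[of 3 "{s \<in> S'. d s \<le> k}"] by auto
    have finX: "finite X" "X \<subseteq> S'" using X finS by (auto intro: finite_subset)
    let ?K = "S' - X"
    have K: "?K \<subseteq> V" "card ?K = k - 2" using S' X finX by (auto simp: card_Diff_subset)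
    have "sum d V = sum d S' + sum d (V - S')" by (rule split[OF S'(1)])
    moreover have "sum d S' = sum d ?K + sum d X" using finX finS by (metis sum.subset_diff)
    moreover have "sum d X \<le> 3 * k" using X sum_bounded_above[of X d k] by auto
    moreover have "sum d ?K \<le> (k - 2) * (card V - 1)"
    proof -
      have "d v \<le> card V - 1" if "v \<in> ?K" for v
        using degree_less_card[OF real fin, of v] that K by fastforce
      then show ?thesis using sum_bounded_above[of ?K d "card V - 1"] K(2) by auto
    qed
    moreover have "sum d (V - S') \<le> (card V - (k + 1)) * (k - 1)"
      using sum_bounded_above[of "V - S'" d "k - 1"] out split(2)[OF S'(1)] S' by auto
    ultimately have "sum d V \<le> (k - 2) * (card V - 1) + 3 * k + (card V - (k + 1)) * (k - 1)"
      by linarith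
    then show False using sum unfolding m i by (simp add: algebra_simps)
  qed
  obtain Y where Y: "{s \<in> S'. d s \<le> k} \<subseteq> Y" "Y \<subseteq> S'" "card Y = 2"
    using subset_between_with_card[OF finS(2) _ low] S' k by auto
  then obtain a b where ab: "Y = {a, b}" "a \<noteq> b" by (auto simp: card_2_iff)
  define M where "M = {(a, z), (z, a), (z, b), (b, z)}"
  have ne: "a \<noteq> z" "b \<noteq> z" using ab Y S' by auto
  have M: "M \<subseteq> S \<times> S" "sym M" "irrefl M" "card M = 4"
    using ab Y S' ne by (auto simp: M_def sym_def irrefl_def)
  have MY: "card (M `` {s}) = of_bool (s \<in> Y) + 2 * of_bool (s = z)" for s
  proof -
    have "M `` {s} = (if s = a then {z} else if s = b then {z} else if s = z then {a, b} else {})"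
      using ab ne by (auto simp: M_def)
    then show ?thesis using ab ne by auto
  qed
  \<comment> \<open>Outer degrees are at most \<open>k - 1\<close>, so this level has no excess and
    only needs enough outer vertices near it. Otherwise \<open>h \<le> 2 * k - 1\<close> and the sum
    is too small.\<close>
  have \<tau>: "k - 1 + 1 \<le> card {x \<in> V - S. k - 1 \<le> d x + 1}"
  proof (rule ccontr)
    assume neg: "\<not> ?thesis"
    let ?A = "{x \<in> V - S. k - 1 \<le> d x + 1}"
    have "card {x \<in> V - S. d x = k - 1} \<le> card ?A" using fin by (intro card_mono) auto
    then have hA: "h \<le> 2 * k - 1" using neg h(2) by linarith
    have cA: "card (S \<union> ?A) \<le> 2 * k + 1" using card_Un_le[of S ?A] S neg k by linarith
    have "sum d V \<le> (2 * k + 1) * (2 * k - 1) + (card V - (2 * k + 1)) * (k - 1)"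
    proof (rule sum_le_two_levels[OF fin, of "S \<union> ?A"])
      show "d v \<le> 2 * k - 1" if "v \<in> V" for v using h(1)[OF that] hA by linarith
    qed (use cA S n le in auto)
    then show False using sum unfolding m i by (simp add: algebra_simps)
  qed
  have "card {x \<in> V - S. d x = k - 1} \<le> card {x \<in> V - S. k - 1 \<le> d x + 1}"
    using fin by (intro card_mono) auto
  then have hB: "h \<le> k + card {x \<in> V - S. k - 1 \<le> d x + 1}" using h(2) by simp
  \<comment> \<open>The estimate is applied to \<open>S'\<close>, with \<open>z\<close> counted
    outside. Its degree then enters twice, and
    \<open>2 * (k - 1) + 4 + (k + 1) * k = (k + 2) * (k + 1)\<close> leaves nothing to
    spare.\<close>
  have total: "sum d S + 4 \<le> (k + 2) * (k + 1) + sum d (V - S)"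
  proof -
    have "V - S' = insert z (V - S)" using S' S by auto
    then have "sum d (V - S') = k - 1 + sum d (V - S)" using z fin by simp
    moreover have "sum d S = k - 1 + sum d S'" using S' z finS by simp
    moreover have "sum d S' \<le> (k + 1) * k + sum d (V - S')"
      using sum_degrees_le[OF real fin S'(1)] cE[OF S'(1)] S'(2) by simp
    ultimately show ?thesis using k by (simp add: algebra_simps)
  qed
  have "\<exists>E'. realizes V d E' \<and> S \<times> S - Id - M \<subseteq> E'"
  proof (rule realize_with_near_clique[OF fin S(1) even_sum_degrees[OF real fin] M(1-3) le _ _ _ le_refl \<tau>])
    show "card S \<le> d s + 1 + card (M `` {s})" if s: "s \<in> S" for s
    proof -
      consider "s = z" | "s \<in> Y" | "s \<in> S' - Y" using s S' by auto
      then show ?thesis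
      proof cases
        case 1
        then show ?thesis using z S k MY[of s] by simp
      next
        case 2
        then show ?thesis using S'k[of s] Y S MY[of s] by auto
      next
        case 3
        then have "k < d s" using Y by auto
        then show ?thesis using S by simp
      qed
    qed
    show "d s + 1 + card (M `` {s}) \<le> card S + card {x \<in> V - S. k - 1 \<le> d x + 1}" if s: "s \<in> S" for s
    proof (cases "s = z")
      case True
      then show ?thesis using z S k Y S' MY[of s] by auto
    next
      case False
      then show ?thesis using h(1)[of s] s S hB MY[of s] by auto
    qed
    show "(\<Sum>x\<in>V - S. d x - (k - 1)) \<le> sum d S + card M - card S * (card S - 1)"
      using le by simp
  qed (use total M S in auto)
  then obtain E' where E': "realizes V d E'" "S \<times> S - Id - M \<subseteq> E'" by blast
  have "almost_complete S E'"
    using E'(2) ab ne Y S' unfolding M_def by (intro almost_complete_pathI[of a z b]) auto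
  then show ?thesis using E' by blast
qed

text \<open>Adding a vertex joined to all of \<open>T\<close> leaves the missing pairs unchanged;
  quantifying over \<open>M\<close> treats both patterns at once.\<close>

lemma almost_complete_extend:
  assumes "almost_complete T E" "T \<subseteq> S"
    and sub: "\<And>M. T \<times> T - Id - M \<subseteq> E \<Longrightarrow> S \<times> S - Id - M \<subseteq> E'"
  shows "almost_complete S E'"
  using assms(1) unfolding almost_complete_def[of T]
proof (elim disjE exE conjE)
  fix a b c
  assume T: "{a, b, c} \<subseteq> T" and dist: "distinct [a, b, c]" and M: "T \<times> T - Id - {(a, b), (b, a), (b, c), (c, b)} \<subseteq> E"
  show ?thesis by (rule almost_complete_pathI[OF subset_trans[OF T assms(2)] dist sub[OF M]])
next
  fix a b c e
  assume T: "{a, b, c, e} \<subseteq> T" and dist: "distinct [a, b, c, e]" and M: "T \<times> T - Id - {(a, b), (b, a), (c, e), (e, c)} \<subseteq> E"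
  show ?thesis by (rule almost_complete_matchingI[OF subset_trans[OF T assms(2)] dist sub[OF M]])
qed

text \<open>The least degree \<open>p\<close> in \<open>S\<close> decides the construction: a
  missing matching from \<open>k\<close> on, a missing path at \<open>k - 1\<close>. Below that, all
  but \<open>k + 1\<close> vertices have degree at most \<open>k - 2\<close>, and the sum is too
  small.\<close>

lemma flat_case:
  fixes d :: "'a \<Rightarrow> nat"
  assumes real: "realizes V d E" and fin: "finite V"
    and S: "S \<subseteq> V" "card S = k + 2" and k: "k \<ge> 2" and n: "card V \<ge> 4 * k + 14"
    and sum: "(k - 1) * (2 * card V - k) + 2 \<le> sum d V"
    and le: "\<And>x. x \<in> V - S \<Longrightarrow> d x \<le> p" and ge: "\<And>s. s \<in> S \<Longrightarrow> p \<le> d s"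
    and z: "z \<in> S" "d z = p"
    and h: "\<And>v. v \<in> V \<Longrightarrow> d v \<le> h" "h \<le> k + card {x \<in> V - S. d x = p}"
  shows "\<exists>E'. realizes V d E' \<and> almost_complete S E'"
proof -
  consider "k \<le> p" | "p = k - 1" | "p \<le> k - 2" by linarith
  then show ?thesis
  proof cases
    case 1
    then show ?thesis using flat_high[OF real fin S k n sum le ge z _ h] by blast
  next
    case 2
    then show ?thesis using flat_low[OF real fin S k n sum] le z h by blast
  next
    case 3
    let ?K = "S - {z}"
    have finS: "finite S" using S fin by (auto intro: finite_subset)
    have K: "?K \<subseteq> V" "card ?K = k + 1" using S z finS by auto
    have "finite ?K" using finS by simp
    have "E \<inter> ?K \<times> ?K \<subseteq> ?K \<times> ?K - Id" using realizesD(3)[OF real] by (auto simp: irrefl_def)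
    then have "card (E \<inter> ?K \<times> ?K) \<le> (k + 1) * k"
      using card_offdiag[OF \<open>finite ?K\<close>] card_mono[of "?K \<times> ?K - Id" "E \<inter> ?K \<times> ?K"] finS K by auto
    then have "sum d ?K \<le> (k + 1) * k + sum d (V - ?K)"
      using sum_degrees_le[OF real fin K(1)] by linarith
    moreover have "sum d V = sum d ?K + sum d (V - ?K)"
      using K(1) fin by (metis add.commute sum.subset_diff)
    moreover have "d v \<le> k - 2" if "v \<in> V - ?K" for v
      using le[of v] z 3 that by (cases "v = z") auto
    then have "sum d (V - ?K) \<le> card (V - ?K) * (k - 2)"
      using sum_bounded_above[of "V - ?K" d "k - 2"] by auto
    moreover have "card (V - ?K) = card V - (k + 1)"
      using K fin \<open>finite ?K\<close> by (metis card_Diff_subset)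
    ultimately have "sum d V \<le> (k + 1) * k + 2 * ((card V - (k + 1)) * (k - 2))" by simp
    moreover obtain m where "card V = 4 * k + 14 + m" using n le_Suc_ex by blast
    moreover obtain i where "k = 2 + i" using k le_Suc_ex by blast
    ultimately show ?thesis using sum by (simp add: algebra_simps)
  qed
qed

section \<open>Peeling off a vertex of maximum degree\<close>

lemma exists_top_subset:
  fixes d :: "'a \<Rightarrow> nat"
  assumes "finite U" "m \<le> card U"
  shows "\<exists>W\<subseteq>U. card W = m \<and> (\<forall>w\<in>W. \<forall>x\<in>U - W. d x \<le> d w)"
  using assms(2)
proof (induction m)
  case (Suc m)
  then obtain W where W: "W \<subseteq> U" "card W = m" "\<And>w x. w \<in> W \<Longrightarrow> x \<in> U - W \<Longrightarrow> d x \<le> d w" by auto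
  have "U - W \<noteq> {}" using W Suc.prems by auto
  then have ne: "d ` (U - W) \<noteq> {}" "finite (d ` (U - W))" using assms(1) by auto
  obtain y where y: "y \<in> U - W" "d y = Max (d ` (U - W))" using Max_in[OF ne(2,1)] by auto
  then have "d x \<le> d y" if "x \<in> U - W" for x using that ne by simp
  moreover have "card (insert y W) = Suc m"
    using W y finite_subset[OF W(1) assms(1)] by simp
  ultimately show ?case using W y by (intro exI[of _ "insert y W"]) auto
qed auto

text \<open>Ties in degree are broken in favour of \<open>T\<close>. For the neighbours of
  \<open>v\<close> and \<open>T = S - {v}\<close> only two cases remain: all neighbours lie in
  \<open>S\<close>, or \<open>v\<close> is joined to the rest of \<open>S\<close>.\<close>

lemma exists_comparable_top_subset:
  fixes d :: "'a \<Rightarrow> nat"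
  assumes fin: "finite U" and T: "T \<subseteq> U" "\<And>s x. s \<in> T \<Longrightarrow> x \<in> U - T \<Longrightarrow> d x \<le> d s" and m: "m \<le> card U"
  obtains W where "W \<subseteq> U" "card W = m" "\<And>w x. w \<in> W \<Longrightarrow> x \<in> U - W \<Longrightarrow> d x \<le> d w"
    "W \<subseteq> T \<or> T \<subseteq> W"
proof (cases "m \<le> card T")
  case True
  have "finite T" using T fin by (auto intro: finite_subset)
  from exists_top_subset[OF this True, of d] obtain W
    where "W \<subseteq> T" "card W = m" "\<And>w x. w \<in> W \<Longrightarrow> x \<in> T - W \<Longrightarrow> d x \<le> d w" by blast
  then show ?thesis using T by (intro that[of W]) blast+
next
  case False
  have "finite T" using T fin by (auto intro: finite_subset)
  have "m - card T \<le> card (U - T)" using m T fin \<open>finite T\<close> by (simp add: card_Diff_subset)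
  from exists_top_subset[OF _ this, of d] fin obtain W
    where W: "W \<subseteq> U - T" "card W = m - card T" "\<And>w x. w \<in> W \<Longrightarrow> x \<in> U - T - W \<Longrightarrow> d x \<le> d w" by auto
  have "card (T \<union> W) = card T + card W"
    using W(1) \<open>finite T\<close> fin by (intro card_Un_disjoint) (auto intro: finite_subset)
  then show ?thesis using W T False by (intro that[of "T \<union> W"]) auto
qed

text \<open>
  Peeling off a vertex \<open>v\<close> of maximum degree and passing from \<open>(k, n)\<close> to \<open>(k - 1, n - 1)\<close>
  lowers the bound by \<open>2 * (n - 1)\<close>, at least as much as the degree sum. This keeps \<open>S - {v}\<close> on
  top unless many vertices outside \<open>S\<close> share the least degree in \<open>S\<close>.
\<close>

theorem exists_almost_complete:
  fixes d :: "'a \<Rightarrow> nat"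
  assumes "k \<ge> 1" "realizes V d E" "finite V" "S \<subseteq> V" "card S = k + 2"
    and "\<And>s x. s \<in> S \<Longrightarrow> x \<in> V - S \<Longrightarrow> d x \<le> d s"
    and "card V \<ge> 4 * k + 14" "(k - 1) * (2 * card V - k) + 2 \<le> sum d V"
  shows "\<exists>E'. realizes V d E' \<and> almost_complete S E'"
  using assms
proof (induction k arbitrary: V d E S rule: less_induct)
  case (less k)
  note k = less.prems(1) and real = less.prems(2) and fin = less.prems(3) and S = less.prems(4,5)
    and top = less.prems(6) and n = less.prems(7) and sum = less.prems(8)
  have finS: "finite S" using S fin by (auto intro: finite_subset)
  then have neS: "d ` S \<noteq> {}" "finite (d ` S)" using S by auto
  obtain v where v: "v \<in> S" "d v = Max (d ` S)" using Max_in[OF neS(2,1)] by auto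
  have max: "d u \<le> d v" if "u \<in> V" for u
    using that v neS(2) top[of v u] by (cases "u \<in> S") auto
  have vV: "v \<in> V" using v S by auto
  have dv: "d v \<le> card (V - {v})" using degree_less_card[OF real fin vV] fin vV by simp
  obtain W where W: "W \<subseteq> V - {v}" "card W = d v"
    and topW: "\<And>w x. w \<in> W \<Longrightarrow> x \<in> V - {v} - W \<Longrightarrow> d x \<le> d w"
    and WS: "W \<subseteq> S - {v} \<or> S - {v} \<subseteq> W"
  proof (rule exists_comparable_top_subset[OF _ _ _ dv, of "S - {v}" d])
    show "d x \<le> d s" if "s \<in> S - {v}" "x \<in> V - {v} - (S - {v})" for s x
      using top[of s x] that by auto
  qed (use fin S in auto)
  obtain E1 where E1: "realizes V d E1" "E1 `` {v} = W"
    using obtain_realization_with_neighbourhood[OF real fin vV W, of thesis] topW by blast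
  have cS: "card (S - {v}) = k + 1" using S v finS by simp
  have finW: "finite W" using W fin by (auto intro: finite_subset)
  note symE1 = realizesD(2)[OF E1(1)]
  show ?case
  proof (cases "k = 1")
    case True
    \<comment> \<open>Three vertices need only one edge, since the other two pairs form a missing
      path. A positive maximum degree gives \<open>v\<close> a neighbour in
      \<open>S\<close>.\<close>
    have "d v > 0"
    proof (rule ccontr)
      assume "\<not> 0 < d v"
      then have "sum d V = 0" using max by (intro sum.neutral) force
      then show False using sum by simp
    qed
    then have "W \<noteq> {}" using W by auto
    moreover have "S - {v} \<noteq> {}" using cS by (metis card.empty add_is_0 one_neq_zero)
    ultimately have "W \<inter> (S - {v}) \<noteq> {}" using WS by blast
    then obtain w where w: "w \<in> S" "w \<noteq> v" "(v, w) \<in> E1" using E1 by auto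
    have "card (S - {v, w}) = 1" using S True v w finS by (simp add: card_Diff_subset)
    then obtain c where c: "S - {v, w} = {c}" by (auto simp: card_1_singleton_iff)
    then have Svwc: "S = {v, w, c}" "c \<noteq> v" "c \<noteq> w" using v w by auto
    have "(w, v) \<in> E1" using w symE1 by (auto dest: symD)
    then have "S \<times> S - Id - {(v, c), (c, v), (c, w), (w, c)} \<subseteq> E1" using Svwc w by auto
    then have "almost_complete S E1"
      using Svwc w by (intro almost_complete_pathI[of v c w]) auto
    then show ?thesis using E1 by blast
  next
    case False
    then have k2: "k \<ge> 2" using k by simp
    have flat: ?thesis if z: "z \<in> S" "\<And>x. x \<in> V - S \<Longrightarrow> d x \<le> d z" "\<And>s. s \<in> S \<Longrightarrow> d z \<le> d s"
      and b: "d v \<le> k + card {x \<in> V - S. d x = d z}" for z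
      using flat_case[OF real fin S k2 n sum z(2,3,1) refl max b] by blast
    obtain z where z: "z \<in> S" "d z = Min (d ` S)" using Min_in[OF neS(2,1)] by auto
    have zmin: "d z \<le> d s" if "s \<in> S" for s using that z neS by simp
    show ?thesis
    proof (cases "d v \<le> k")
      case True
      then show ?thesis using flat[OF z(1) top[OF z(1)] zmin] by simp
    next
      case False
      have SW: "S - {v} \<subseteq> W"
      proof (rule ccontr)
        assume "\<not> S - {v} \<subseteq> W"
        then have "W \<subset> S - {v}" using WS by auto
        then have "card W < k + 1" using psubset_card_mono[of "S - {v}" W] finS cS by simp
        then show False using W False by simp
      qed
      show ?thesis
      proof (cases "\<forall>s\<in>S - {v}. \<forall>x\<in>V - {v} - W. d x < d s")
        case False
        \<comment> \<open>A tie between \<open>S\<close> and a non-neighbour \<open>x\<close> of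
          \<open>v\<close>: all \<open>d v - (k + 1)\<close> neighbours of \<open>v\<close> outside
          \<open>S\<close> then share this degree, and together with \<open>x\<close> they make the
          flat case applicable.\<close>
        then obtain s x where s: "s \<in> S - {v}" and x: "x \<in> V - {v} - W" and "d s \<le> d x"
          by (auto simp: not_less)
        moreover have "d x \<le> d s" using topW s x SW by auto
        ultimately have eq: "d x = d s" by simp
        have xS: "x \<notin> S" using x SW by auto
        have smin: "d s \<le> d u" if "u \<in> S" for u
          using top[OF that, of x] x xS eq by auto
        have "d w = d s" if w: "w \<in> W - (S - {v})" for w
          using topW[of w x] top[of s w] w x s eq W by (intro antisym) auto
        then have "insert x (W - (S - {v})) \<subseteq> {y \<in> V - S. d y = d s}"
          using eq x xS W by auto
        then have "card (insert x (W - (S - {v}))) \<le> card {y \<in> V - S. d y = d s}"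
          using fin by (intro card_mono) auto
        moreover have "card (insert x (W - (S - {v}))) = d v - (k + 1) + 1"
          using x finW W SW cS finS by (simp add: card_Diff_subset)
        ultimately have "d v \<le> k + card {y \<in> V - S. d y = d s}" by simp
        then show ?thesis using flat[of s] s top smin by auto
      next
        case True
        let ?d = "\<lambda>x. d x - of_bool (x \<in> W)"
        have real': "realizes (V - {v}) ?d (E1 \<inter> (V - {v}) \<times> (V - {v}))"
          using realizes_delete_vertex[OF E1(1) fin vV] E1(2) by simp
        \<comment> \<open>Members of \<open>W\<close> all lose one, which keeps their order; a
          vertex outside \<open>W\<close> keeps its degree, and the strict gap absorbs the loss in
          \<open>S\<close>.\<close>
        have top': "?d x \<le> ?d s" if "s \<in> S - {v}" "x \<in> V - {v} - (S - {v})" for s x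
        proof (cases "x \<in> W")
          case True
          then show ?thesis using that top[of s x] SW by (auto intro: diff_le_mono)
        next
          case False
          then have "d x < d s" using \<open>\<forall>s\<in>S - {v}. _\<close> that by auto
          then show ?thesis using that SW by auto
        qed
        have pos: "d x > 0" if "x \<in> W" for x
          using that E1 symE1 by (intro realizes_degree_pos[OF E1(1) fin, of x v]) (auto dest: symD)
        have "(\<Sum>x\<in>V - {v}. ?d x) + d v = sum d (V - {v})"
          using sum_diff_of_bool[of "V - {v}" W d] W fin pos by simp
        moreover have "sum d V = d v + sum d (V - {v})" using vV fin by (simp add: sum.remove)
        moreover have "d v \<le> card V - 1" using degree_less_card[OF real fin vV] by simp
        moreover have cV: "card (V - {v}) = card V - 1" using vV fin by simp
        moreover obtain m where m: "card V = 4 * k + 14 + m" using n le_Suc_ex by blast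
        moreover obtain i where i: "k = 2 + i" using k2 le_Suc_ex by blast
        ultimately have sum': "(k - 1 - 1) * (2 * card (V - {v}) - (k - 1)) + 2 \<le> (\<Sum>x\<in>V - {v}. ?d x)"
          using sum by (simp add: algebra_simps)
        have "\<exists>E'. realizes (V - {v}) ?d E' \<and> almost_complete (S - {v}) E'"
        proof (rule less.IH[OF _ _ real' _ _ _ top'])
          show "card (S - {v}) = k - 1 + 2" using cS k2 by simp
        qed (use sum' k2 fin S n cV in auto)
        then obtain E2 where E2: "realizes (V - {v}) ?d E2" "almost_complete (S - {v}) E2" by blast
        let ?E = "E2 \<union> {v} \<times> W \<union> W \<times> {v}"
        have "realizes (insert v (V - {v})) d ?E"
        proof (rule realizes_add_vertex[OF E2(1)])
          show "d x = ?d x + of_bool (x \<in> W)" for x using pos[of x] by auto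
        qed (use W fin in auto)
        then have "realizes V d ?E" using vV by (simp add: insert_absorb)
        moreover have "almost_complete S ?E"
        proof -
          have sub: "S \<times> S - Id - M \<subseteq> ?E" if "(S - {v}) \<times> (S - {v}) - Id - M \<subseteq> E2" for M
            using that SW by blast
          show ?thesis by (rule almost_complete_extend[OF E2(2) _ sub]) auto
        qed
        ultimately show ?thesis by blast
      qed
    qed
  qed
qed

section \<open>Transfer to pair graphs\<close>

lemma out_degree_with_proj: "out_degree (with_proj G) v = card (parcs G `` {v})"
proof -
  have "out_arcs (with_proj G) v = Pair v ` (parcs G `` {v})"
    by (auto simp: out_arcs_def)
  then show ?thesis by (simp add: out_degree_def card_image inj_on_def)
qed

lemma pair_graph_realizes:
  assumes "pair_graph G"
  shows "realizes (pverts G) (out_degree (with_proj G)) (parcs G)" "finite (pverts G)"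
proof -
  interpret pair_graph G by fact
  show "realizes (pverts G) (out_degree (with_proj G)) (parcs G)"
    using in_arcsD1 in_arcsD2 no_loops' arcs_symmetric
    by (fastforce simp: realizes_def out_degree_with_proj irrefl_def sym_def)
  show "finite (pverts G)" by (rule pair_finite_verts)
qed

lemma realizes_pair_graph:
  assumes "realizes V d E" "finite V"
  shows "pair_graph \<lparr>pverts = V, parcs = E\<rparr>"
proof -
  have "finite E" using assms by (auto simp: realizes_def intro: finite_subset)
  then show ?thesis
    using assms by unfold_locales (auto simp: realizes_def irrefl_def symmetric_def)
qed

lemma mset_degree_sequence:
  "mset (degree_sequence G) = image_mset (out_degree (with_proj G)) (mset_set (pverts G))"
  by (simp add: degree_sequence_def)

lemma length_degree_sequence: "length (degree_sequence G) = card (pverts G)"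
  by (metis mset_degree_sequence size_image_mset size_mset size_mset_set)

lemma sum_list_degree_sequence:
  "sum_list (degree_sequence G) = (\<Sum>v\<in>pverts G. out_degree (with_proj G) v)"
  by (metis mset_degree_sequence sum_mset_sum_list sum_unfold_sum_mset)

lemma degree_sequence_cong:
  assumes "finite V" "\<And>v. v \<in> V \<Longrightarrow> out_degree (with_proj G) v = out_degree (with_proj G') v"
    "pverts G = V" "pverts G' = V"
  shows "degree_sequence G = degree_sequence G'"
proof -
  have "image_mset (out_degree (with_proj G)) (mset_set V) = image_mset (out_degree (with_proj G')) (mset_set V)"
    using assms(1,2) by (intro image_mset_cong) simp
  then show ?thesis using assms(3,4) by (simp add: degree_sequence_def)
qed

text \<open>On pair digraphs tail and head are the projections, so the arc map of an isomorphism is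
  determined by its vertex map.\<close>

lemma digraph_iso_with_proj_iff:
  "digraph_iso (with_proj F) (with_proj H) \<longleftrightarrow>
     pair_wf_digraph F \<and>
     (\<exists>f. inj_on f (pverts F) \<and> pverts H = f ` pverts F \<and> parcs H = map_prod f f ` parcs F)"
  (is "?L \<longleftrightarrow> ?R")
proof
  assume ?L
  then obtain g where g: "pre_digraph.digraph_isomorphism (with_proj F) g"
    and H: "with_proj H = app_iso g (with_proj F)"
    by (auto simp: digraph_iso_def)
  note g' = g[unfolded pre_digraph.digraph_isomorphism_def wf_digraph_wp_iff with_proj_simps]
  let ?f = "iso_verts g"
  have H': "pverts H = ?f ` pverts F" "parcs H = iso_arcs g ` parcs F"
    "fst = iso_tail g" "snd = iso_head g"
    using arg_cong[OF H, of verts] arg_cong[OF H, of arcs] arg_cong[OF H, of tail] arg_cong[OF H, of head]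
    by simp_all
  have "iso_arcs g e = map_prod ?f ?f e" if "e \<in> parcs F" for e
    using g' that H'(3,4) by (simp add: prod_eq_iff)
  then have "parcs H = map_prod ?f ?f ` parcs F" using H'(2) by simp
  then show ?R using g' H'(1) by blast
next
  assume ?R
  then obtain f where F: "pair_wf_digraph F" and f: "inj_on f (pverts F)"
    "pverts H = f ` pverts F" "parcs H = map_prod f f ` parcs F" by blast
  define g where "g = \<lparr>iso_verts = f, iso_arcs = map_prod f f, iso_head = snd, iso_tail = fst\<rparr>"
  have "parcs F \<subseteq> pverts F \<times> pverts F"
    using F by (auto dest: pair_wf_digraph.arc_fst_in_verts pair_wf_digraph.arc_snd_in_verts)
  then have "inj_on (map_prod f f) (parcs F)"
    using map_prod_inj_on[OF f(1) f(1)] by (rule inj_on_subset[rotated])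
  then have "pre_digraph.digraph_isomorphism (with_proj F) g"
    using F f by (simp add: pre_digraph.digraph_isomorphism_def g_def wf_digraph_wp_iff)
  moreover have "with_proj H = app_iso g (with_proj F)"
    using f by (simp add: g_def with_proj_def app_iso_def)
  ultimately show ?L by (auto simp: digraph_iso_def)
qed

text \<open>Names the vertices of the deleted subgraph: \<open>b\<close> is the middle of the path,
  \<open>d\<close> and \<open>e\<close> are the ends of the separate edge.\<close>

lemma obtain_path_and_edge:
  assumes "subgraph (with_proj H) (with_proj (complete_graph m))"
    and "digraph_iso (with_proj (disjoint_union (path_graph 2) (complete_graph 2))) (with_proj H)"
  obtains a b c d e where "distinct [a, b, c, d, e]" "{a, b, c, d, e} \<subseteq> {..<m}"
    "parcs H = {(a, b), (b, a), (b, c), (c, b), (d, e), (e, d)}"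
proof -
  let ?U = "disjoint_union (path_graph 2) (complete_graph 2)"
  obtain f where f: "inj_on f (pverts ?U)" "pverts H = f ` pverts ?U" "parcs H = map_prod f f ` parcs ?U"
    using assms(2) by (auto simp: digraph_iso_with_proj_iff)
  have "{..2} = {0, 1, 2 :: nat}" "{..<2} = {0, 1 :: nat}" by auto
  then have V: "pverts ?U = {Inl 0, Inl 1, Inl 2, Inr 0, Inr 1}"
    by (auto simp: disjoint_union_def path_graph_def complete_graph_def)
  have P: "parcs (path_graph 2) = {(0, 1), (1, 0), (1, 2), (2, 1)}"
    by (auto simp: path_graph_def)
  have K: "parcs (complete_graph 2) = {(0, 1), (1, 0)}"
    by (auto simp: complete_graph_def)
  have A: "parcs H = {(f (Inl 0), f (Inl 1)), (f (Inl 1), f (Inl 0)), (f (Inl 1), f (Inl 2)), (f (Inl 2), f (Inl 1)),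
      (f (Inr 0), f (Inr 1)), (f (Inr 1), f (Inr 0))}"
    unfolding f(3) by (simp add: disjoint_union_def P K insert_commute)
  have "pverts H \<subseteq> {..<m}" using assms(1) by (simp add: subgraph_def complete_graph_def)
  then show ?thesis
    using that[OF _ _ A] f(1,2) unfolding V by (auto simp: inj_on_def)
qed

section \<open>Copying a graph into a near-clique\<close>

text \<open>With five vertices either pattern grows to the full one: a path takes fresh
  \<open>d\<close> and \<open>e\<close>, a matching takes a fresh \<open>c\<close> next to
  \<open>b\<close>. Excluding more pairs only weakens the inclusion.\<close>

lemma almost_complete_obtain:
  assumes "almost_complete S E" "card S \<ge> 5"
  obtains a b c d e where "distinct [a, b, c, d, e]" "{a, b, c, d, e} \<subseteq> S"
    "S \<times> S - Id - {(a, b), (b, a), (b, c), (c, b), (d, e), (e, d)} \<subseteq> E"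
proof -
  have fresh: "\<exists>x\<in>S. x \<notin> set xs" if "length xs < 5" for xs
  proof (rule ccontr)
    assume "\<not> ?thesis"
    then have "card S \<le> card (set xs)" by (intro card_mono) auto
    then show False using that assms(2) card_length[of xs] by linarith
  qed
  from assms(1) show ?thesis unfolding almost_complete_def
  proof (elim disjE exE conjE)
    fix a b c
    assume abc: "{a, b, c} \<subseteq> S" "distinct [a, b, c]"
      and M: "S \<times> S - Id - {(a, b), (b, a), (b, c), (c, b)} \<subseteq> E"
    obtain d where d: "d \<in> S" "d \<notin> set [a, b, c]" using fresh[of "[a, b, c]"] by auto
    obtain e where e: "e \<in> S" "e \<notin> set [a, b, c, d]" using fresh[of "[a, b, c, d]"] by auto
    show ?thesis
    proof (rule that[of a b c d e])
      show "S \<times> S - Id - {(a, b), (b, a), (b, c), (c, b), (d, e), (e, d)} \<subseteq> E" using M by blast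
    qed (use abc d e in auto)
  next
    fix a b d e
    assume abde: "{a, b, d, e} \<subseteq> S" "distinct [a, b, d, e]"
      and M: "S \<times> S - Id - {(a, b), (b, a), (d, e), (e, d)} \<subseteq> E"
    obtain c where c: "c \<in> S" "c \<notin> set [a, b, d, e]" using fresh[of "[a, b, d, e]"] by auto
    show ?thesis
    proof (rule that[of a b c d e])
      show "S \<times> S - Id - {(a, b), (b, a), (b, c), (c, b), (d, e), (e, d)} \<subseteq> E" using M by blast
    qed (use abde c in auto)
  qed
qed

text \<open>Lists instead of sets prescribe where each named vertex goes; the complements have equal
  size and are matched arbitrarily.\<close>

lemma bij_betw_extend_list:
  assumes "finite A" "finite B" "card A = card B" "distinct xs" "set xs \<subseteq> A" "distinct ys" "set ys \<subseteq> B"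
    and "length xs = length ys"
  obtains f where "bij_betw f A B" "map f xs = ys"
proof -
  let ?n = "length xs"
  have "card (A - set xs) = card (B - set ys)"
    using assms by (simp add: card_Diff_subset distinct_card)
  then obtain f0 where f0: "bij_betw f0 (A - set xs) (B - set ys)"
    using finite_same_card_bij[of "A - set xs" "B - set ys"] assms(1,2) by auto
  have nth: "bij_betw ((!) xs) {..<?n} (set xs)" "bij_betw ((!) ys) {..<?n} (set ys)"
    using assms by (auto intro: bij_betw_nth)
  define f where "f x = (if x \<in> set xs then ys ! inv_into {..<?n} ((!) xs) x else f0 x)" for x
  have "bij_betw (\<lambda>x. ys ! inv_into {..<?n} ((!) xs) x) (set xs) (set ys)"
    using bij_betw_trans[OF bij_betw_inv_into[OF nth(1)] nth(2)] by (simp add: comp_def)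
  then have "bij_betw f (set xs) (set ys)"
    by (subst bij_betw_cong[of _ f "\<lambda>x. ys ! inv_into {..<?n} ((!) xs) x"]) (auto simp: f_def)
  moreover have "bij_betw f (A - set xs) (B - set ys)"
    using f0 by (subst bij_betw_cong[of _ f f0]) (auto simp: f_def)
  ultimately have "bij_betw f (set xs \<union> (A - set xs)) (set ys \<union> (B - set ys))"
    by (rule bij_betw_combine) auto
  moreover have "set xs \<union> (A - set xs) = A" "set ys \<union> (B - set ys) = B" using assms by auto
  moreover have "map f xs = ys"
  proof (rule nth_equalityI)
    fix i assume "i < length (map f xs)"
    then have "inv_into {..<?n} ((!) xs) (xs ! i) = i" "i < ?n"
      using nth(1) by (auto intro: inv_into_f_f simp: bij_betw_def)
    then show "map f xs ! i = ys ! i" by (simp add: f_def)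
  qed (use assms in simp)
  ultimately show ?thesis using that by simp
qed

lemma contains_copyI:
  assumes "pair_graph G" "pair_wf_digraph F" "inj_on f (pverts F)" "f ` pverts F \<subseteq> pverts G"
    "map_prod f f ` parcs F \<subseteq> parcs G"
  shows "contains_copy G F"
proof -
  interpret pair_graph G by fact
  let ?H = "\<lparr>pverts = f ` pverts F, parcs = map_prod f f ` parcs F\<rparr>"
  have "pair_wf_digraph ?H"
    using pair_wf_digraph.arc_fst_in_verts[OF assms(2)] pair_wf_digraph.arc_snd_in_verts[OF assms(2)]
    by unfold_locales auto
  then have "subgraph (with_proj ?H) (with_proj G)"
    using assms(4,5) wf_digraph by (simp add: subgraph_def compatible_def wf_digraph_wp_iff)
  moreover have "digraph_iso (with_proj F) (with_proj ?H)"
    using assms by (auto simp: digraph_iso_with_proj_iff)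
  ultimately show ?thesis unfolding contains_copy_def by blast
qed


section \<open>Sequences with a large degree sum\<close>

text \<open>Links the natural-number bound for \<open>k = r - 1\<close> with the integer formula;
  the hypotheses keep all truncated subtractions exact.\<close>

lemma sum_bound_int:
  assumes "r \<ge> 4" "n \<ge> 4 * r + 10"
  shows "int ((r - 1 - 1) * (2 * n - (r - 1)) + 2) = (int r - 1) * (2 * int n - int r) - 2 * (int n - int r)"
proof -
  obtain i where r: "r = 4 + i" using assms(1) le_Suc_ex by blast
  obtain m where n: "n = 4 * r + 10 + m" using assms(2) le_Suc_ex by blast
  show ?thesis unfolding n r by (simp add: algebra_simps)
qed

lemma pair_wf_digraph_delete_edges_complete_graph:
  "pair_wf_digraph (delete_edges (complete_graph m) H)"
  by unfold_locales (auto simp: delete_edges_def complete_graph_def)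

text \<open>\<open>exists_almost_complete\<close> is applied with \<open>k = r - 1\<close>, so
  \<open>S\<close> has \<open>r + 1\<close> vertices. The bijection onto \<open>S\<close> sends the
  deleted path and edge to the pairs that may be missing, hence every kept edge to a present
  one.\<close>

lemma potentially_graphic_if_sum_large:
  fixes r n :: nat and H :: "nat pair_pre_digraph"
  assumes r: "r \<ge> 4" and n: "n \<ge> 4 * r + 10"
    and H: "subgraph (with_proj H) (with_proj (complete_graph (r + 1)))"
      "digraph_iso (with_proj (disjoint_union (path_graph 2) (complete_graph 2))) (with_proj H)"
    and d: "length d = n" "graphic d"
      "int (sum_list d) \<ge> (int r - 1) * (2 * int n - int r) - 2 * (int n - int r)"
  shows "potentially_graphic (delete_edges (complete_graph (r + 1)) H) d"
proof -
  let ?F = "delete_edges (complete_graph (r + 1)) H"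
  obtain G :: "nat pair_pre_digraph" where G: "pair_graph G" "degree_sequence G = d"
    using d(2) unfolding graphic_def realization_def by blast
  define V where "V = pverts G"
  define deg where "deg = out_degree (with_proj G)"
  have real: "realizes V deg (parcs G)" and fin: "finite V"
    using pair_graph_realizes[OF G(1)] by (simp_all add: V_def deg_def)
  have cV: "card V = n" using length_degree_sequence[of G] G(2) d(1) by (simp add: V_def)
  have sumV: "sum deg V = sum_list d" using sum_list_degree_sequence[of G] G(2) by (simp add: V_def deg_def)
  have sum: "(r - 1 - 1) * (2 * card V - (r - 1)) + 2 \<le> sum deg V"
    using d(3) unfolding sum_bound_int[OF r n, symmetric] of_nat_le_iff sumV cV .
  obtain S where S: "S \<subseteq> V" "card S = r + 1" "\<And>s x. s \<in> S \<Longrightarrow> x \<in> V - S \<Longrightarrow> deg x \<le> deg s"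
    using exists_top_subset[OF fin, of "r + 1" deg] cV n by auto
  have "\<exists>E'. realizes V deg E' \<and> almost_complete S E'"
    by (rule exists_almost_complete[of "r - 1", OF _ real fin S(1) _ S(3) _ sum])
      (use r n S(2) cV in auto)
  then obtain E' where E': "realizes V deg E'" "almost_complete S E'" by blast
  have finS: "finite S" using S(1) fin by (rule finite_subset)
  define G' where "G' = \<lparr>pverts = V, parcs = E'\<rparr>"
  have G': "pair_graph G'" unfolding G'_def using realizes_pair_graph[OF E'(1) fin] .
  have eq: "out_degree (with_proj G') v = out_degree (with_proj G) v" if "v \<in> V" for v
    using realizesD(4)[OF E'(1) that] unfolding out_degree_with_proj[of G'] by (simp add: G'_def deg_def)
  have "degree_sequence G' = degree_sequence G"
    by (rule degree_sequence_cong[OF fin eq]) (simp_all add: G'_def V_def)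
  then have "degree_sequence G' = d" using G(2) by simp
  then have "realization G' d" using G' by (simp add: realization_def)
  moreover have "contains_copy G' ?F"
  proof -
    obtain a b c x y where abc: "distinct [a, b, c, x, y]" "{a, b, c, x, y} \<subseteq> {..<r + 1}"
      and arcs: "parcs H = {(a, b), (b, a), (b, c), (c, b), (x, y), (y, x)}"
      using obtain_path_and_edge[OF H] by metis
    have c5: "card S \<ge> 5" using S(2) r by simp
    obtain a' b' c' x' y' where abc': "distinct [a', b', c', x', y']" "{a', b', c', x', y'} \<subseteq> S"
      and M: "S \<times> S - Id - {(a', b'), (b', a'), (b', c'), (c', b'), (x', y'), (y', x')} \<subseteq> E'"
      using almost_complete_obtain[OF E'(2) c5] by metis
    obtain f where f: "bij_betw f {..<r + 1} S" "map f [a, b, c, x, y] = [a', b', c', x', y']"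
      using bij_betw_extend_list[of "{..<r + 1}" S "[a, b, c, x, y]" "[a', b', c', x', y']"]
        finS S(2) abc abc' by auto
    have inj: "inj_on f {..<r + 1}" and im: "f ` {..<r + 1} = S" using f(1) by (auto simp: bij_betw_def)
    have F: "pverts ?F = {..<r + 1}" "parcs ?F = {..<r + 1} \<times> {..<r + 1} - Id - parcs H"
      by (auto simp: delete_edges_def complete_graph_def)
    have "map_prod f f ` parcs ?F \<subseteq> E'"
    proof (rule subset_trans[OF _ M], rule subsetI)
      fix e assume "e \<in> map_prod f f ` parcs ?F"
      then obtain u v where e: "e = (f u, f v)" and uv: "u < r + 1" "v < r + 1" "u \<noteq> v" "(u, v) \<notin> parcs H"
        unfolding F by auto
      have eq: "f u = f w \<longleftrightarrow> u = w" "f v = f w \<longleftrightarrow> v = w" if "w < r + 1" for w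
        using inj uv that by (auto simp: inj_on_def)
      have "f u \<in> S" "f v \<in> S" "f u \<noteq> f v" using im uv eq by auto
      moreover have "(f u, f v) \<notin> {(f a, f b), (f b, f a), (f b, f c), (f c, f b), (f x, f y), (f y, f x)}"
        using uv(4) abc(2) eq unfolding arcs by auto
      ultimately show "e \<in> S \<times> S - Id - {(a', b'), (b', a'), (b', c'), (c', b'), (x', y'), (y', x')}"
        using f(2) e by auto
    qed
    moreover have "f ` {..<r + 1} \<subseteq> V" using im S(1) by simp
    ultimately show ?thesis
      using inj by (intro contains_copyI[OF G' pair_wf_digraph_delete_edges_complete_graph])
        (simp_all only: F(1) G'_def pair_pre_digraph.simps)
  qed
  ultimately show ?thesis by (auto simp: potentially_graphic_def)
qed

section \<open>The extremal sequence\<close>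

text \<open>For \<open>m \<le> n\<close> this is \<open>K_m\<close> joined to \<open>n - m\<close>
  independent vertices: every edge has an end below \<open>m\<close>.\<close>

definition join_graph :: "nat \<Rightarrow> nat \<Rightarrow> nat pair_pre_digraph" where
  "join_graph m n = \<lparr>pverts = {..<n}, parcs = {(u, v). u < n \<and> v < n \<and> u \<noteq> v \<and> (u < m \<or> v < m)}\<rparr>"

lemma pair_graph_join_graph: "pair_graph (join_graph m n)"
proof -
  have "parcs (join_graph m n) \<subseteq> {..<n} \<times> {..<n}" by (auto simp: join_graph_def)
  then have "finite (parcs (join_graph m n))" by (auto intro: finite_subset)
  then show ?thesis by unfold_locales (auto simp: join_graph_def symmetric_def sym_def)
qed

lemma out_degree_join_graph:
  assumes "m \<le> n" "v < n"
  shows "out_degree (with_proj (join_graph m n)) v = (if v < m then n - 1 else m)"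
proof -
  have "parcs (join_graph m n) `` {v} = (if v < m then {..<n} - {v} else {..<m})"
    using assms by (auto simp: join_graph_def)
  then show ?thesis using assms by (simp add: out_degree_with_proj)
qed

lemma sum_list_degree_sequence_join_graph:
  assumes "m \<le> n"
  shows "sum_list (degree_sequence (join_graph m n)) = m * (n - 1) + (n - m) * m"
proof -
  have "sum_list (degree_sequence (join_graph m n)) = (\<Sum>v<n. if v < m then n - 1 else m)"
    unfolding sum_list_degree_sequence using assms out_degree_join_graph
    by (intro sum.cong) (auto simp: join_graph_def)
  also have "{..<n} = {..<m} \<union> {m..<n}" using assms by auto
  also have "(\<Sum>v\<in>{..<m} \<union> {m..<n}. if v < m then n - 1 else m) = m * (n - 1) + (n - m) * m"
    by (subst sum.union_disjoint) auto
  finally show ?thesis .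
qed

text \<open>
  In every realization the vertices of degree \<open>n - 1\<close> see everything, which exhausts
  the degrees of all other vertices.
\<close>

lemma realization_join_graph_independent:
  assumes G: "realization G (degree_sequence (join_graph m n))" and m: "m < n - 1"
  obtains D where "D \<subseteq> pverts G" "card D = m" "\<And>u v. u \<notin> D \<Longrightarrow> v \<notin> D \<Longrightarrow> (u, v) \<notin> parcs G"
proof -
  let ?deg = "out_degree (with_proj G)" and ?joindeg = "out_degree (with_proj (join_graph m n))"
  have G': "pair_graph G" "degree_sequence G = degree_sequence (join_graph m n)"
    using G by (auto simp: realization_def)
  note real = pair_graph_realizes(1)[OF G'(1)] and fin = pair_graph_realizes(2)[OF G'(1)]
  have V0: "pverts (join_graph m n) = {..<n}" by (simp add: join_graph_def)
  have mset: "image_mset ?deg (mset_set (pverts G)) = image_mset ?joindeg (mset_set {..<n})"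
    by (metis G'(2) V0 mset_degree_sequence)
  have cV: "card (pverts G) = n"
    using length_degree_sequence[of G] length_degree_sequence[of "join_graph m n"] G'(2) V0 by simp
  define D where "D = {v \<in> pverts G. ?deg v = n - 1}"
  have "card D = count (image_mset ?deg (mset_set (pverts G))) (n - 1)"
    using fin by (simp add: D_def count_image_mset_eq_card_vimage)
  also have "\<dots> = card {v \<in> {..<n}. ?joindeg v = n - 1}"
    unfolding mset by (subst count_image_mset_eq_card_vimage) auto
  \<comment> \<open>\<open>m < n - 1\<close> keeps the two degree values apart, so the vertices of
    full degree can be counted from the sequence alone.\<close>
  also have "{v \<in> {..<n}. ?joindeg v = n - 1} = {..<m}"
    using m by (auto simp: out_degree_join_graph split: if_splits)
  finally have cD: "card D = m" by simp
  have D: "D \<subseteq> pverts G" "finite D" using fin by (auto simp: D_def)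
  have full: "parcs G `` {v} = pverts G - {v}" if v: "v \<in> D" for v
  proof (rule card_subset_eq)
    show "parcs G `` {v} \<subseteq> pverts G - {v}" using realizesD[OF real] by (auto simp: irrefl_def)
    show "card (parcs G `` {v}) = card (pverts G - {v})"
      using realizesD(4)[OF real, of v] v cV fin by (simp add: D_def)
  qed (use fin in simp)
  have "parcs G `` {v} = D" if v: "v \<in> pverts G - D" for v
  proof (rule card_subset_eq[symmetric])
    show "finite (parcs G `` {v})" using fin realizes_Image_subset[OF real] by (rule finite_subset[rotated])
    show "D \<subseteq> parcs G `` {v}" using full v realizesD(2)[OF real] by (auto dest: symD)
    have "?deg v \<in># image_mset ?joindeg (mset_set {..<n})" unfolding mset[symmetric] using v fin by simp
    then have "?deg v = n - 1 \<or> ?deg v = m" using m by (auto simp: out_degree_join_graph split: if_splits)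
    then have "?deg v = m" using v by (auto simp: D_def)
    then show "card D = card (parcs G `` {v})" using realizesD(4)[OF real, of v] v cD by simp
  qed
  then have "(u, v) \<notin> parcs G" if "u \<notin> D" "v \<notin> D" for u v
    using that realizesD(1)[OF real] by blast
  then show ?thesis using that D(1) cD by blast
qed

lemma join_graph_not_potentially_graphic:
  fixes r n :: nat and H :: "nat pair_pre_digraph"
  assumes r: "r \<ge> 4" and n: "n \<ge> 4 * r + 10"
    and H: "subgraph (with_proj H) (with_proj (complete_graph (r + 1)))"
      "digraph_iso (with_proj (disjoint_union (path_graph 2) (complete_graph 2))) (with_proj H)"
  shows "\<not> potentially_graphic (delete_edges (complete_graph (r + 1)) H) (degree_sequence (join_graph (r - 2) n))"
proof
  let ?F = "delete_edges (complete_graph (r + 1)) H"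
  assume "potentially_graphic ?F (degree_sequence (join_graph (r - 2) n))"
  then obtain G where G: "realization G (degree_sequence (join_graph (r - 2) n))" "contains_copy G ?F"
    by (auto simp: potentially_graphic_def)
  have less: "r - 2 < n - 1" using n by simp
  obtain D where D: "D \<subseteq> pverts G" "card D = r - 2" "\<And>u v. u \<notin> D \<Longrightarrow> v \<notin> D \<Longrightarrow> (u, v) \<notin> parcs G"
    using realization_join_graph_independent[OF G(1) less] by metis
  obtain K where K: "subgraph (with_proj K) (with_proj G)" "digraph_iso (with_proj ?F) (with_proj K)"
    using G(2) by (auto simp: contains_copy_def)
  have F: "pverts ?F = {..<r + 1}" "parcs ?F = {..<r + 1} \<times> {..<r + 1} - Id - parcs H"
    by (auto simp: delete_edges_def complete_graph_def)
  obtain f where f: "inj_on f {..<r + 1}" "parcs K = map_prod f f ` parcs ?F"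
    using K(2) unfolding digraph_iso_with_proj_iff F(1) by blast
  have "parcs K \<subseteq> parcs G" using K(1) by (simp add: subgraph_def)
  then have sub: "map_prod f f ` parcs ?F \<subseteq> parcs G" using f(2) by simp
  have "finite (pverts G)" using pair_graph_realizes(2) G(1) by (auto simp: realization_def)
  then have finD: "finite D" using D(1) finite_subset by blast
  let ?X = "{u \<in> {..<r + 1}. f u \<notin> D}"
  \<comment> \<open>The injective \<open>f\<close> maps at most \<open>r - 2\<close> of the
    \<open>r + 1\<close> vertices into \<open>D\<close>, so at least three are mapped
    outside.\<close>
  have "card {u \<in> {..<r + 1}. f u \<in> D} \<le> r - 2"
    using card_inj_on_le[of f "{u \<in> {..<r + 1}. f u \<in> D}" D] f(1) finD D(2)
    by (auto intro: inj_on_subset)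
  moreover have "?X = {..<r + 1} - {u \<in> {..<r + 1}. f u \<in> D}" by auto
  then have "card ?X = card ({..<r + 1} - {u \<in> {..<r + 1}. f u \<in> D})" by (rule arg_cong)
  moreover have "card ({..<r + 1} - {u \<in> {..<r + 1}. f u \<in> D}) = r + 1 - card {u \<in> {..<r + 1}. f u \<in> D}"
    by (subst card_Diff_subset) auto
  ultimately have "card ?X \<ge> 3" using r by linarith
  then obtain X where "X \<subseteq> ?X" "card X = 3" using obtain_subset_with_card_n[of 3 ?X] by metis
  then obtain u v w where uvw: "distinct [u, v, w]" "u \<in> ?X" "v \<in> ?X" "w \<in> ?X"
    by (auto simp: card_3_iff)
  \<comment> \<open>No edge of \<open>G\<close> avoids \<open>D\<close>, so each such pair must have
    been deleted; three of these vertices would form a triangle in \<open>H\<close>.\<close>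
  have "(s, t) \<in> parcs H" if "s \<in> ?X" "t \<in> ?X" "s \<noteq> t" for s t
  proof (rule ccontr)
    assume "(s, t) \<notin> parcs H"
    then have "(s, t) \<in> parcs ?F" using that F(2) by auto
    then have "(f s, f t) \<in> parcs G" using sub by (force simp: image_subset_iff)
    then show False using D(3) that by auto
  qed
  then have "(u, v) \<in> parcs H" "(v, w) \<in> parcs H" "(u, w) \<in> parcs H" using uvw by auto
  moreover obtain a b c x y where "distinct [a, b, c, x, y]"
    "parcs H = {(a, b), (b, a), (b, c), (c, b), (x, y), (y, x)}"
    using obtain_path_and_edge[OF H] by metis
  ultimately show False using uvw(1) by auto
qed

section \<open>The value of sigma: admissibility and minimality\<close>

theorem theorem1p1:
  fixes r n :: nat and H :: "nat pair_pre_digraph"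
  assumes "r \<ge> 4" and "n \<ge> 4 * r + 10"
    and "subgraph (with_proj H) (with_proj (complete_graph (r + 1)))"
    and "digraph_iso (with_proj (disjoint_union (path_graph 2) (complete_graph 2))) (with_proj H)"
  shows "sigma (delete_edges (complete_graph (r + 1)) H) n
           = (int r - 1) * (2 * int n - int r) - 2 * (int n - int r)"
proof -
  let ?T = "(int r - 1) * (2 * int n - int r) - 2 * (int n - int r)"
  let ?d = "degree_sequence (join_graph (r - 2) n)"
  have "length ?d = n" by (simp add: length_degree_sequence join_graph_def)
  moreover have "graphic ?d"
    using pair_graph_join_graph by (auto simp: graphic_def realization_def)
  moreover have T: "int (sum_list ?d) = ?T - 2"
  proof -
    obtain i where r: "r = 4 + i" using assms(1) le_Suc_ex by blast
    obtain m where n: "n = 4 * r + 10 + m" using assms(2) le_Suc_ex by blast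
    have "sum_list ?d = (r - 2) * (n - 1) + (n - (r - 2)) * (r - 2)"
      using assms(2) by (intro sum_list_degree_sequence_join_graph) simp
    then show ?thesis unfolding n r by (simp only:) (simp add: algebra_simps)
  qed
  \<comment> \<open>Any admissible \<open>l\<close>, even or odd, must exceed the degree sum of the
    join; parity is used only at the end.\<close>
  ultimately have low: "?T - 2 < l"
    if "\<forall>d. length d = n \<and> graphic d \<and> int (sum_list d) \<ge> l \<longrightarrow>
      potentially_graphic (delete_edges (complete_graph (r + 1)) H) d" for l
    using join_graph_not_potentially_graphic[OF assms] that by (metis not_less)
  have "even ?T"
  proof -
    have "?T = 2 * (int n * (int r - 2)) - int r * (int r - 3)" by (simp add: algebra_simps)
    \<comment> \<open>\<open>r\<close> and \<open>r - 3\<close> have opposite parity.\<close>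
    moreover have "even (int r * (int r - 3))" by simp
    ultimately show ?thesis by simp
  qed
  show ?thesis unfolding sigma_def
  proof (rule Least_equality, intro conjI)
    show "even ?T" by fact
    show "\<forall>d. length d = n \<and> graphic d \<and> int (sum_list d) \<ge> ?T \<longrightarrow>
      potentially_graphic (delete_edges (complete_graph (r + 1)) H) d"
      using potentially_graphic_if_sum_large[OF assms] by blast
  next
    fix l :: int
    assume l: "even l \<and> (\<forall>d. length d = n \<and> graphic d \<and> int (sum_list d) \<ge> l \<longrightarrow>
      potentially_graphic (delete_edges (complete_graph (r + 1)) H) d)"
    then have "?T - 2 < l" using low by blast
    \<comment> \<open>Only \<open>l = ?T - 1\<close> is left to exclude, and it is odd.\<close>
    then have "?T \<noteq> l + 1 \<Longrightarrow> ?T \<le> l" by linarith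
    moreover have "?T \<noteq> l + 1" using l \<open>even ?T\<close> by (metis even_plus_one_iff)
    ultimately show "?T \<le> l" by blast
  qed
qed

end
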